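(* Consider the system of partial differential equations $$\partial_\mu d_\nu=-2\,\frac{x_\mu d_\nu-x_\nu d_\mu}{x_\mu^2-x_\nu^2}\qquad\text{for all }\mu\neq\nu,$$ for the vector of functions $d_1,\dots,d_n$ of $(x_1,\dots,x_n)$, where $\partial_\mu=\partial/\partial x_\mu$. Any functions of the form $$d_\mu=\partial_\mu D,\qquad D=\sum_{\mu=1}^n\frac{X_\mu}{U_\mu},\qquad U_\mu=\prod_{\nu\neq\mu}(x_\nu^2-x_\mu^2),$$ where $X_\mu=X_\mu(x_\mu)$ are arbitrary smooth functions of the individual indicated coordinates, are a solution of the system. Moreover, on any open, connected and simply-connected domain that avoids the partial diagonals (where $x_\mu=\pm x_\nu$ for $\mu\ne\nu$) and the hyperplanes $x_\mu=0$, every solution of the system must have this form.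
   Context: Greek indices run over $1,\dots,n$ with no implicit summation. The domain is a domain in $\mathbb R^n$ with coordinates $(x_1,\dots,x_n)$, and the functions $d_\mu$ are smooth. An empty product equals $1$.
   Formalization: In the formal version X_μ is only locally a smooth function of x_μ alone: on a C-shaped simply connected domain the converse fails with one global one-variable X_μ. Where all slices x_μ = const of the domain are connected, the two readings agree. *)

theory Defs
  imports "HOL-Analysis.Analysis"
begin

(* C^k and smooth real-valued functions; only meaningful for open S.  The derivative of f in the
   basis direction b is the value of the Frechet derivative at b. *)

primrec Ck_on :: "nat \<Rightarrow> ('a::euclidean_space \<Rightarrow> real) \<Rightarrow> 'a set \<Rightarrow> bool" where
  "Ck_on 0 f S \<longleftrightarrow> continuous_on S f"
| "Ck_on (Suc k) f S \<longleftrightarrow>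
     (\<forall>x\<in>S. f differentiable (at x)) \<and>
     (\<forall>b\<in>Basis. Ck_on k (\<lambda>x. frechet_derivative f (at x) b) S)"

definition smooth_on :: "('a::euclidean_space \<Rightarrow> real) \<Rightarrow> 'a set \<Rightarrow> bool" where
  "smooth_on f S \<longleftrightarrow> (\<forall>k. Ck_on k f S)"

definition partial :: "'n::finite \<Rightarrow> (real^'n \<Rightarrow> real) \<Rightarrow> real^'n \<Rightarrow> real" where
  "partial \<mu> f x = frechet_derivative f (at x) (axis \<mu> 1)"

definition solves_system :: "(real^'n::finite) set \<Rightarrow> ('n \<Rightarrow> real^'n \<Rightarrow> real) \<Rightarrow> bool" where
  "solves_system \<Omega> d \<longleftrightarrow>
     (\<forall>\<mu>. smooth_on (d \<mu>) \<Omega>) \<and>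
     (\<forall>x\<in>\<Omega>. \<forall>\<mu> \<nu>. \<mu> \<noteq> \<nu> \<longrightarrow>
        partial \<mu> (d \<nu>) x
          = - 2 * ((x $ \<mu> * d \<nu> x - x $ \<nu> * d \<mu> x) / ((x $ \<mu>)\<^sup>2 - (x $ \<nu>)\<^sup>2)))"

definition U :: "'n::finite \<Rightarrow> real^'n \<Rightarrow> real" where
  "U \<mu> x = (\<Prod>\<nu>\<in>UNIV - {\<mu>}. (x $ \<nu>)\<^sup>2 - (x $ \<mu>)\<^sup>2)"

definition potential :: "('n::finite \<Rightarrow> real^'n \<Rightarrow> real) \<Rightarrow> real^'n \<Rightarrow> real" where
  "potential X x = (\<Sum>\<mu>\<in>UNIV. X \<mu> x / U \<mu> x)"

(* X is a smooth function X = X(x_\<mu>) of the coordinate x_\<mu> alone, as a function on \<Omega>: every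
   point of \<Omega> has a neighbourhood on which X is a smooth one-variable function of x_\<mu>
   (equivalently, X is smooth and its other partial derivatives vanish on \<Omega>).  The one-variable
   function may not be required to be the same on all of \<Omega>: the slices {x \<in> \<Omega>. x_\<mu> = t} of a
   simply connected \<Omega> can be disconnected, and on a C-shaped planar domain there are solutions
   whose X_1 takes different values on different components of a slice.  See
   smooth_coordinate_function_global for connected slices. *)

definition smooth_coordinate_function ::
  "(real^'n::finite) set \<Rightarrow> 'n \<Rightarrow> (real^'n \<Rightarrow> real) \<Rightarrow> bool" where
  "smooth_coordinate_function \<Omega> \<mu> X \<longleftrightarrow>
     (\<forall>p\<in>\<Omega>. \<exists>W \<xi>. open W \<and> p \<in> W \<and> W \<subseteq> \<Omega> \<and>
        smooth_on \<xi> ((\<lambda>x. x $ \<mu>) ` W) \<and> (\<forall>x\<in>W. X x = \<xi> (x $ \<mu>)))"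

definition has_potential_form :: "(real^'n::finite) set \<Rightarrow> ('n \<Rightarrow> real^'n \<Rightarrow> real) \<Rightarrow> bool" where
  "has_potential_form \<Omega> d \<longleftrightarrow>
     (\<exists>X. (\<forall>\<mu>. smooth_coordinate_function \<Omega> \<mu> (X \<mu>)) \<and>
          (\<forall>\<mu>. \<forall>x\<in>\<Omega>. d \<mu> x = partial \<mu> (potential X) x))"

lemma Ck_on_subset: "Ck_on k f S \<Longrightarrow> T \<subseteq> S \<Longrightarrow> Ck_on k f T"
  by (induction k arbitrary: f) (auto intro: continuous_on_subset)

lemma Ck_on_cong_open:
  assumes "open T" "\<And>x. x \<in> T \<Longrightarrow> f x = g x" "Ck_on k f T"
  shows "Ck_on k g T"
  using assms(2,3)
proof (induction k arbitrary: f g)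
  case 0
  then show ?case by (simp cong: continuous_on_cong)
next
  case (Suc k)
  have der: "(g has_derivative frechet_derivative f (at x)) (at x)" if "x \<in> T" for x
  proof -
    have "(f has_derivative frechet_derivative f (at x)) (at x)"
      using Suc.prems(2) that frechet_derivative_works by auto
    then show ?thesis
      by (rule has_derivative_transform_within_open) (use assms(1) that Suc.prems(1) in auto)
  qed
  then have "frechet_derivative g (at x) = frechet_derivative f (at x)" if "x \<in> T" for x
    using frechet_derivative_at[OF der[OF that]] by simp
  then have "Ck_on k (\<lambda>x. frechet_derivative g (at x) b) T" if "b \<in> Basis" for b
    using Suc.prems(2) that by - (rule Suc.IH[of "\<lambda>x. frechet_derivative f (at x) b"], simp_all)
  moreover have "g differentiable (at x)" if "x \<in> T" for x
    using der[OF that] by (rule differentiableI)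
  ultimately show ?case by simp
qed

lemma Ck_on_local:
  assumes "\<And>x. x \<in> S \<Longrightarrow> \<exists>T. open T \<and> x \<in> T \<and> Ck_on k f T"
  shows "Ck_on k f S"
  using assms
proof (induction k arbitrary: f)
  case 0
  then have "isCont f x" if "x \<in> S" for x
    using 0[OF that] by (auto simp: continuous_on_eq_continuous_at)
  then show ?case by (simp add: continuous_at_imp_continuous_on)
next
  case (Suc k)
  have "f differentiable (at x)" if "x \<in> S" for x
    using Suc.prems[OF that] by auto
  moreover have "Ck_on k (\<lambda>x. frechet_derivative f (at x) b) S" if "b \<in> Basis" for b
  proof (rule Suc.IH)
    fix x assume "x \<in> S"
    then obtain T where "open T" "x \<in> T" "Ck_on (Suc k) f T" using Suc.prems by blast
    then show "\<exists>T. open T \<and> x \<in> T \<and> Ck_on k (\<lambda>x. frechet_derivative f (at x) b) T"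
      using that by (intro exI[of _ T]) simp
  qed
  ultimately show ?case by simp
qed

lemma smooth_coordinate_functionI:
  assumes "open \<Omega>" "smooth_on \<xi> ((\<lambda>x. x $ \<mu>) ` \<Omega>)"
  shows "smooth_coordinate_function \<Omega> \<mu> (\<lambda>x. \<xi> (x $ \<mu>))"
  unfolding smooth_coordinate_function_def
proof
  fix p assume "p \<in> \<Omega>"
  then show "\<exists>W \<eta>. open W \<and> p \<in> W \<and> W \<subseteq> \<Omega> \<and>
      smooth_on \<eta> ((\<lambda>x. x $ \<mu>) ` W) \<and> (\<forall>x\<in>W. \<xi> (x $ \<mu>) = \<eta> (x $ \<mu>))"
    using assms by (intro exI[of _ \<Omega>] exI[of _ \<xi>]) simp
qed

lemma smooth_coordinate_function_global:
  fixes \<Omega> :: "(real^'n::finite) set"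
  assumes X: "smooth_coordinate_function \<Omega> \<mu> X"
    and slices: "\<And>t. connected {x \<in> \<Omega>. x $ \<mu> = t}"
  shows "\<exists>\<xi>. smooth_on \<xi> ((\<lambda>x. x $ \<mu>) ` \<Omega>) \<and> (\<forall>x\<in>\<Omega>. X x = \<xi> (x $ \<mu>))"
proof -
  have const: "X x = X y" if "x \<in> \<Omega>" "y \<in> \<Omega>" "x $ \<mu> = y $ \<mu>" for x y
  proof -
    define S where "S = {z \<in> \<Omega>. z $ \<mu> = x $ \<mu>}"
    have "\<exists>c. \<forall>z\<in>S. X z = c"
    proof -
      have "\<exists>T. openin (top_of_set S) T \<and> a \<in> T \<and> (\<forall>z\<in>T. X z = X a)" if a: "a \<in> S" for a
      proof -
        obtain W \<xi> where W: "open W" "a \<in> W" "\<forall>z\<in>W. X z = \<xi> (z $ \<mu>)"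
          using X a unfolding smooth_coordinate_function_def S_def mem_Collect_eq by metis
        have "openin (top_of_set S) (S \<inter> W)" using W(1) by (simp add: openin_open_Int)
        moreover have "\<forall>z\<in>S \<inter> W. X z = X a" using W a by (auto simp: S_def)
        ultimately show ?thesis using W(2) a by blast
      qed
      moreover have "connected S" using slices by (simp add: S_def)
      ultimately have "X constant_on S"
        by (intro locally_constant_imp_constant)
      then show ?thesis by (auto simp: constant_on_def)
    qed
    then obtain c where "\<forall>z\<in>S. X z = c" ..
    moreover have "x \<in> S" "y \<in> S" using that by (simp_all add: S_def)
    ultimately show ?thesis by simp
  qed
  define \<xi> where "\<xi> t = X (SOME x. x \<in> \<Omega> \<and> x $ \<mu> = t)" for t
  have eq: "X x = \<xi> (x $ \<mu>)" if "x \<in> \<Omega>" for x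
  proof -
    have "(SOME y. y \<in> \<Omega> \<and> y $ \<mu> = x $ \<mu>) \<in> \<Omega> \<and> (SOME y. y \<in> \<Omega> \<and> y $ \<mu> = x $ \<mu>) $ \<mu> = x $ \<mu>"
      by (rule someI[of _ x]) (use that in auto)
    then show ?thesis unfolding \<xi>_def using that by (intro const) simp_all
  qed
  have "Ck_on k \<xi> ((\<lambda>x. x $ \<mu>) ` \<Omega>)" for k
  proof (rule Ck_on_local)
    fix t assume "t \<in> (\<lambda>x. x $ \<mu>) ` \<Omega>"
    then obtain p where p: "p \<in> \<Omega>" "t = p $ \<mu>" by auto
    obtain W \<eta> where W: "open W" "p \<in> W" "W \<subseteq> \<Omega>" "smooth_on \<eta> ((\<lambda>x. x $ \<mu>) ` W)"
        "\<forall>z\<in>W. X z = \<eta> (z $ \<mu>)"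
      using X p unfolding smooth_coordinate_function_def by metis
    have op: "open ((\<lambda>x. x $ \<mu>) ` W)" using W(1) open_image_vec_nth by blast
    have "Ck_on k \<xi> ((\<lambda>x. x $ \<mu>) ` W)"
    proof (rule Ck_on_cong_open[OF op])
      show "\<eta> s = \<xi> s" if "s \<in> (\<lambda>x. x $ \<mu>) ` W" for s
      proof -
        from that obtain z where z: "z \<in> W" "s = z $ \<mu>" by auto
        then have "z \<in> \<Omega>" using W(3) by auto
        then show ?thesis using W(5) eq[of z] z by metis
      qed
      show "Ck_on k \<eta> ((\<lambda>x. x $ \<mu>) ` W)" using W(4) by (simp add: smooth_on_def)
    qed
    then show "\<exists>T. open T \<and> t \<in> T \<and> Ck_on k \<xi> T" using op p(2) W(2)
      by (intro exI[of _ "(\<lambda>x. x $ \<mu>) ` W"]) simp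
  qed
  then show ?thesis using eq by (auto simp: smooth_on_def)
qed

end

theory Submission
  imports Defs
begin

text \<open>
Put \<open>y\<^sub>\<mu> = x\<^sub>\<mu>\<^sup>2\<close>.  Up to sign, \<open>D = \<Sum>\<^sub>\<mu> X\<^sub>\<mu> / U\<^sub>\<mu>\<close> is the divided difference of the data \<open>X\<^sub>\<mu>\<close> at the nodes
\<open>y\<^sub>\<mu>\<close>, that is, the leading coefficient of the polynomial \<open>Q(t)\<close> that takes the value \<open>X\<^sub>\<mu>\<close> at \<open>t = y\<^sub>\<mu>\<close>.
For \<open>d = grad D\<close> the system says that \<open>(y\<^sub>\<mu> - y\<^sub>\<nu>) D\<close> has vanishing mixed derivative in \<open>x\<^sub>\<mu>\<close> and \<open>x\<^sub>\<nu>\<close>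
for all \<open>\<mu> \<noteq> \<nu>\<close>; this is an Euler-Poisson-Darboux equation.

Potentials of the given form solve it because of the recursion of divided differences:
\<open>(y\<^sub>\<mu> - y\<^sub>\<nu>) D\<close> is the divided difference without the node \<open>y\<^sub>\<mu>\<close> minus the one without \<open>y\<^sub>\<nu>\<close>
(\<open>divided_difference_recursion\<close>).  The first does not involve \<open>x\<^sub>\<mu>\<close>, the second does not involve
\<open>x\<^sub>\<nu>\<close>, so the mixed derivative of the difference is zero (\<open>mixed_partial_of_independent\<close>).

For the converse the whole polynomial \<open>Q\<close> is reconstructed from the solution.  If the \<open>X\<^sub>\<mu>\<close> exist, then
\<open>\<partial>\<^sub>\<mu> Q\<close> is a polynomial of degree less than \<open>n\<close> that vanishes at all nodes except \<open>y\<^sub>\<mu>\<close>; it is therefore a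
multiple of \<open>\<Prod>\<^sub>\<nu>\<^sub>\<noteq>\<^sub>\<mu> (y\<^sub>\<nu> - t)\<close>, and comparison of leading coefficients gives, up to a global sign,
\<open>\<partial>\<^sub>\<mu> Q(t) = d\<^sub>\<mu> \<Prod>\<^sub>\<nu>\<^sub>\<noteq>\<^sub>\<mu> (y\<^sub>\<nu> - t)\<close>.
Conversely, let \<open>d\<close> be any solution.  The system is exactly what is needed for the right-hand sides to form
a closed field for every \<open>t\<close> (\<open>solution_coefficients_closed\<close>), so on a simply connected domain
each coefficient \<open>q\<^sub>k\<close> of \<open>Q = \<Sum>\<^sub>k q\<^sub>k t\<^sup>k\<close> exists globally (\<open>closed_coefficients_have_potential\<close>).
Put \<open>X\<^sub>\<mu> = Q(y\<^sub>\<mu>)\<close>.  For \<open>\<nu> \<noteq> \<mu>\<close> the derivative \<open>\<partial>\<^sub>\<nu> X\<^sub>\<mu> = d\<^sub>\<nu> \<Prod>\<^sub>\<kappa>\<^sub>\<noteq>\<^sub>\<nu> (y\<^sub>\<kappa> - y\<^sub>\<mu>)\<close> vanishes because \<open>\<kappa> = \<mu>\<close>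
is among the factors, so \<open>X\<^sub>\<mu>\<close> is locally a function of \<open>x\<^sub>\<mu>\<close>.  Lagrange interpolation
(\<open>sum_powers_div_nodal\<close>) identifies \<open>\<Sum>\<^sub>\<mu> X\<^sub>\<mu> / U\<^sub>\<mu>\<close> with the top coefficient of \<open>Q\<close> up to sign, and its
gradient is \<open>d\<close>.  The \<open>X\<^sub>\<mu>\<close> are unique only up to the values \<open>p(y\<^sub>\<mu>)\<close> of a common polynomial \<open>p\<close>, so that
local choices need not agree; integrating every coefficient of \<open>Q\<close> over the whole domain makes the choice at once
for all points.

The existence of potentials of closed fields rests on two facts.  Integrals along segments inside a ball are
additive around triangles (\<open>line_integral_triangle\<close>), and a function of pairs of points with
this local additivity is globally a difference \<open>F y - F x\<close> on a simply connected open set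
(\<open>simply_connected_cocycle_trivial\<close>).
\<close>

section \<open>Monodromy on simply connected sets\<close>

text \<open>The typical example is \<open>L x y = F y - F x\<close> for a function \<open>F\<close> that may only exist locally.  Additivity is
required inside a common ball because balls, unlike arbitrary open sets, carry no monodromy of their own.\<close>

definition local_cocycle :: "'a::real_normed_vector set \<Rightarrow> ('a \<Rightarrow> 'a \<Rightarrow> real) \<Rightarrow> bool" where
  "local_cocycle S L \<longleftrightarrow>
     (\<forall>c r x y z. ball c r \<subseteq> S \<longrightarrow> {x, y, z} \<subseteq> ball c r \<longrightarrow> L x y + L y z = L x z)"

text \<open>A continuation of the locally existing \<open>F\<close> along the map \<open>g\<close>: \<open>h\<close> plays the role of \<open>F \<circ> g\<close>.  The same \<open>\<delta>\<close>
serves the whole of \<open>T\<close>, which makes restriction to edges and subintervals immediate.\<close>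

definition primitive_along ::
  "('a \<Rightarrow> 'a \<Rightarrow> real) \<Rightarrow> 'b::metric_space set \<Rightarrow> ('b \<Rightarrow> 'a) \<Rightarrow> ('b \<Rightarrow> real) \<Rightarrow> bool" where
  "primitive_along L T g h \<longleftrightarrow>
     (\<exists>\<delta>>0. \<forall>s\<in>T. \<forall>s'\<in>T. dist s s' < \<delta> \<longrightarrow> h s' - h s = L (g s) (g s'))"

lemma local_cocycleD:
  assumes "local_cocycle S L" "ball c r \<subseteq> S" "x \<in> ball c r" "y \<in> ball c r" "z \<in> ball c r"
  shows "L x y + L y z = L x z"
  using assms unfolding local_cocycle_def by (metis empty_subsetI insert_subset)

lemma local_cocycle_same:
  assumes "local_cocycle S L" "open S" "x \<in> S"
  shows "L x x = 0"
proof -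
  obtain r where "r > 0" "ball x r \<subseteq> S" using assms open_contains_ball by blast
  then show ?thesis using local_cocycleD[OF assms(1), of x r x x x] by simp
qed

lemma primitive_along_compose:
  assumes "primitive_along L T g h" "\<phi> ` T' \<subseteq> T" "\<And>s s'. dist (\<phi> s) (\<phi> s') \<le> dist s s'"
    and "\<And>s. s \<in> T' \<Longrightarrow> g (\<phi> s) = g' s"
  shows "primitive_along L T' g' (h \<circ> \<phi>)"
proof -
  obtain \<delta> where \<delta>: "\<delta> > 0" "\<forall>s\<in>T. \<forall>s'\<in>T. dist s s' < \<delta> \<longrightarrow> h s' - h s = L (g s) (g s')"
    using assms(1) unfolding primitive_along_def by blast
  have "h (\<phi> s') - h (\<phi> s) = L (g' s) (g' s')" if "s \<in> T'" "s' \<in> T'" "dist s s' < \<delta>" for s s'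
  proof -
    have "dist (\<phi> s) (\<phi> s') < \<delta>" using assms(3)[of s s'] that by linarith
    moreover have "\<phi> s \<in> T" "\<phi> s' \<in> T" using assms(2) that by auto
    ultimately show ?thesis using \<delta>(2) assms(4) that by auto
  qed
  then show ?thesis using \<delta>(1) by (auto simp: primitive_along_def)
qed

text \<open>Two continuations have the same increments over short distances, hence their difference is locally constant.\<close>

lemma primitive_along_unique:
  assumes "connected T" "primitive_along L T g h" "primitive_along L T g k" "s \<in> T" "t \<in> T"
  shows "h t - h s = k t - k s"
proof -
  obtain \<delta> where \<delta>: "\<delta> > 0" "\<forall>s\<in>T. \<forall>s'\<in>T. dist s s' < \<delta> \<longrightarrow> h s' - h s = L (g s) (g s')"
    using assms(2) unfolding primitive_along_def by blast
  obtain \<epsilon> where \<epsilon>: "\<epsilon> > 0" "\<forall>s\<in>T. \<forall>s'\<in>T. dist s s' < \<epsilon> \<longrightarrow> k s' - k s = L (g s) (g s')"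
    using assms(3) unfolding primitive_along_def by blast
  have "(\<lambda>s. h s - k s) constant_on T"
  proof (rule locally_constant_imp_constant[OF assms(1)])
    fix a assume a: "a \<in> T"
    have "openin (top_of_set T) (T \<inter> ball a (min \<delta> \<epsilon>))" by (simp add: openin_open_Int)
    moreover have "a \<in> T \<inter> ball a (min \<delta> \<epsilon>)" using a \<delta> \<epsilon> by simp
    moreover have "h x - k x = h a - k a" if x: "x \<in> T \<inter> ball a (min \<delta> \<epsilon>)" for x
    proof -
      have "h x - h a = L (g a) (g x)" "k x - k a = L (g a) (g x)"
        using \<delta>(2) \<epsilon>(2) a x by auto
      then show ?thesis by simp
    qed
    ultimately show "\<exists>V. openin (top_of_set T) V \<and> a \<in> V \<and> (\<forall>x\<in>V. h x - k x = h a - k a)"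
      by blast
  qed
  then obtain c where "\<And>x. x \<in> T \<Longrightarrow> h x - k x = c" by (auto simp: constant_on_def)
  from this[OF assms(4)] this[OF assms(5)] show ?thesis by simp
qed

text \<open>From a fixed point \<open>a\<close> of the convex set \<open>T\<close> walk to \<open>s\<close> along the segment in \<open>N\<close> equal steps and add up
the values of \<open>L\<close> on their images.  When \<open>s\<close> moves slightly to \<open>s'\<close>, the two chains of image points bound \<open>N\<close>
small quadrilaterals, each inside one ball, and the contributions of their rungs telescope; only the last rung,
from \<open>g s\<close> to \<open>g s'\<close>, remains.\<close>

lemma primitive_along_exists:
  fixes g :: "'b::euclidean_space \<Rightarrow> 'a::euclidean_space"
  assumes L: "local_cocycle S L" and "open S"
    and T: "compact T" "convex T" and g: "continuous_on T g" "g ` T \<subseteq> S"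
  shows "\<exists>h. primitive_along L T g h"
proof (cases "T = {}")
  case True
  then show ?thesis unfolding primitive_along_def by (auto intro: exI[of _ "1::real"])
next
  case False
  then obtain a where a: "a \<in> T" by blast
  obtain r where r: "r > 0" "(\<Union>x\<in>g ` T. ball x r) \<subseteq> S"
    using compact_subset_open_imp_ball_epsilon_subset[OF compact_continuous_image[OF g(1) T(1)] \<open>open S\<close> g(2)]
    by blast
  have "uniformly_continuous_on T g"
    using compact_uniformly_continuous g(1) T(1) by blast
  then obtain \<delta> where \<delta>: "\<delta> > 0"
      "\<And>s s'. s \<in> T \<Longrightarrow> s' \<in> T \<Longrightarrow> dist s' s < \<delta> \<Longrightarrow> dist (g s') (g s) < r / 2"
    using r(1) unfolding uniformly_continuous_on_def by (metis half_gt_zero)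
  obtain M where M: "\<And>s. s \<in> T \<Longrightarrow> dist a s \<le> M"
    using bounded_any_center compact_imp_bounded[OF T(1)] by blast
  have "M \<ge> 0" using M[OF a] by simp
  obtain N :: nat where "M / \<delta> < N" using reals_Archimedean2 by blast
  then have N: "N > 0" "M < \<delta> * N"
    using \<open>M \<ge> 0\<close> \<delta>(1) by (auto simp: field_simps intro: Nat.gr0I)
  define p where "p s k = a + (real k / N) *\<^sub>R (s - a)" for s k
  define h where "h s = (\<Sum>k<N. L (g (p s k)) (g (p s (Suc k))))" for s
  have pT: "p s k \<in> T" if "s \<in> T" "k \<le> N" for s k
  proof -
    have "p s k = (1 - real k / N) *\<^sub>R a + (real k / N) *\<^sub>R s"
      by (simp add: p_def algebra_simps)
    then show ?thesis using T(2) a that N(1) by (simp add: convexD_alt)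
  qed
  have step: "dist (p s (Suc k)) (p s k) < \<delta>" if "s \<in> T" for s k
  proof -
    have "p s (Suc k) - p s k = (1 / N) *\<^sub>R (s - a)"
      by (simp add: p_def add_divide_distrib algebra_simps)
    then have "dist (p s (Suc k)) (p s k) = dist a s / N"
      using N(1) by (simp add: dist_norm norm_minus_commute)
    also have "\<dots> < \<delta>" using M[OF that] N by (simp add: field_simps)
    finally show ?thesis .
  qed
  have near: "dist (p s' k) (p s k) \<le> dist s s'" if "k \<le> N" for s s' k
  proof -
    have "p s' k - p s k = (real k / N) *\<^sub>R (s' - s)" by (simp add: p_def algebra_simps)
    then have "dist (p s' k) (p s k) = (real k / N) * dist s s'"
      by (simp add: dist_norm norm_minus_commute)
    also have "\<dots> \<le> dist s s'" using that N(1) by (intro mult_left_le_one_le) auto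
    finally show ?thesis .
  qed
  have "h s' - h s = L (g s) (g s')" if s: "s \<in> T" "s' \<in> T" "dist s s' < \<delta>" for s s'
  proof -
    have cell: "L (g (p s' k)) (g (p s' (Suc k))) - L (g (p s k)) (g (p s (Suc k)))
        = L (g (p s (Suc k))) (g (p s' (Suc k))) - L (g (p s k)) (g (p s' k))" if k: "k < N" for k
    proof -
      let ?c = "g (p s k)"
      have B: "ball ?c r \<subseteq> S" using r(2) pT[OF s(1), of k] k by auto
      have inT: "p s k \<in> T" "p s (Suc k) \<in> T" "p s' k \<in> T" "p s' (Suc k) \<in> T"
        using pT s k by simp_all
      have 1: "dist (g (p s (Suc k))) ?c < r / 2" using \<delta>(2) inT step[OF s(1)] by simp
      have 2: "dist (g (p s' k)) ?c < r / 2"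
        using \<delta>(2) inT near[of k s' s] s(3) k by simp
      have 3: "dist (g (p s' (Suc k))) (g (p s' k)) < r / 2" using \<delta>(2) inT step[OF s(2)] by simp
      \<comment> \<open>The two tolerances \<open>r / 2\<close> of uniform continuity, one for the step along the segment and one for the
        move from \<open>s\<close> to \<open>s'\<close>, add up to the radius \<open>r\<close>.\<close>
      have 4: "dist (g (p s' (Suc k))) ?c < r" using dist_triangle_half_l 2 3
        by (metis dist_commute)
      have mem: "?c \<in> ball ?c r" "g (p s (Suc k)) \<in> ball ?c r" "g (p s' k) \<in> ball ?c r"
          "g (p s' (Suc k)) \<in> ball ?c r"
        using 1 2 4 r(1) by (simp_all add: dist_commute)
      show ?thesis
        using local_cocycleD[OF L B mem(1,2,4)] local_cocycleD[OF L B mem(1,3,4)] by simp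
    qed
    have "h s' - h s
        = (\<Sum>k<N. L (g (p s (Suc k))) (g (p s' (Suc k))) - L (g (p s k)) (g (p s' k)))"
      unfolding h_def sum_subtractf[symmetric] by (intro sum.cong) (simp_all add: cell)
    also have "\<dots> = L (g (p s N)) (g (p s' N)) - L (g (p s 0)) (g (p s' 0))"
      by (rule sum_lessThan_telescope)
    also have "\<dots> = L (g s) (g s')"
      using N(1) local_cocycle_same[OF L \<open>open S\<close>, of "g a"] a g(2) by (auto simp: p_def)
    finally show ?thesis .
  qed
  then show ?thesis using \<delta>(1) by (auto simp: primitive_along_def)
qed

text \<open>Continue over the whole square of the homotopy.  Its two vertical sides carry the paths, and along the other
two sides the homotopy is constant, so the continuation is constant there.\<close>

lemma primitive_along_homotopic_paths:
  fixes p q :: "real \<Rightarrow> 'a::euclidean_space"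
  assumes L: "local_cocycle S L" and "open S" and "homotopic_paths S p q"
    and h: "primitive_along L {0..1} p h" and k: "primitive_along L {0..1} q k"
  shows "h 1 - h 0 = k 1 - k 0"
proof -
  obtain H where H: "continuous_on ({0..1} \<times> {0..1}) H" "H \<in> ({0..1} \<times> {0..1}) \<rightarrow> S"
      "\<forall>x\<in>{0..1::real}. H (0::real, x) = p x" "\<forall>x\<in>{0..1}. H (1, x) = q x"
      "\<forall>t\<in>{0..1}. pathstart (H \<circ> Pair t) = pathstart p \<and> pathfinish (H \<circ> Pair t) = pathfinish p"
    using assms(3) unfolding homotopic_paths by blast
  have "\<exists>m. primitive_along L ({0..1} \<times> {0..1}) H m"
    using H by (intro primitive_along_exists[OF L \<open>open S\<close>])
      (auto intro: compact_Times convex_Times)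
  then obtain m where m: "primitive_along L ({0..1} \<times> {0..1}) H m" by blast
  have edge: "primitive_along L {0..1} f (m \<circ> \<phi>)"
    if "\<phi> = Pair t \<or> \<phi> = (\<lambda>s. (s, t))" "t \<in> {0..1}" "\<And>s. s \<in> {0..1} \<Longrightarrow> H (\<phi> s) = f s" for f \<phi> t
    using that by (intro primitive_along_compose[OF m]) (auto simp: dist_Pair_Pair)
  have side: "primitive_along L {0..1::real} (\<lambda>_. c) (\<lambda>_. 0)" if "c \<in> S" for c
    using local_cocycle_same[OF L \<open>open S\<close> that]
    by (auto simp: primitive_along_def intro: exI[of _ "1::real"])
  have inS: "H (0, 0) \<in> S" "H (0, 1) \<in> S" using H(2) by auto
  have I: "connected {0..1::real}" "0 \<in> {0..1::real}" "1 \<in> {0..1::real}" by auto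
  have bottom: "H (s, 0) = H (0, 0)" and top: "H (s, 1) = H (0, 1)" if "s \<in> {0..1}" for s
    using H(3,5) that by (auto simp: pathstart_def pathfinish_def)
  have "primitive_along L {0..1} p (m \<circ> Pair 0)" using H(3) by (intro edge[of _ 0]) auto
  from primitive_along_unique[OF I(1) this h I(2,3)]
  have "m (0, 1) - m (0, 0) = h 1 - h 0" by simp
  moreover have "primitive_along L {0..1} q (m \<circ> Pair 1)" using H(4) by (intro edge[of _ 1]) auto
  from primitive_along_unique[OF I(1) this k I(2,3)]
  have "m (1, 1) - m (1, 0) = k 1 - k 0" by simp
  moreover have "primitive_along L {0..1} (\<lambda>_. H (0, 0)) (m \<circ> (\<lambda>s. (s, 0)))"
    by (rule edge[of "\<lambda>s. (s, 0)" 0]) (auto intro: bottom)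
  from primitive_along_unique[OF I(1) this side[OF inS(1)] I(2,3)]
  have "m (1, 0) = m (0, 0)" by simp
  moreover have "primitive_along L {0..1} (\<lambda>_. H (0, 1)) (m \<circ> (\<lambda>s. (s, 1)))"
    by (rule edge[of "\<lambda>s. (s, 1)" 1]) (auto intro: top)
  from primitive_along_unique[OF I(1) this side[OF inS(2)] I(2,3)]
  have "m (1, 1) = m (0, 1)" by simp
  ultimately show ?thesis by simp
qed

text \<open>The monodromy theorem: \<open>F x\<close> is the increment of a continuation along any path from a base point to \<open>x\<close>,
which is independent of the path because all such paths are homotopic.\<close>

theorem simply_connected_cocycle_trivial:
  fixes S :: "'a::euclidean_space set"
  assumes L: "local_cocycle S L" and "open S" and S: "simply_connected S"
  shows "\<exists>F. \<forall>c r x y. ball c r \<subseteq> S \<longrightarrow> x \<in> ball c r \<longrightarrow> y \<in> ball c r \<longrightarrow> F y - F x = L x y"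
proof (cases "S = {}")
  case True
  then show ?thesis by (metis empty_iff subset_empty)
next
  case False
  then obtain x0 where x0: "x0 \<in> S" by blast
  have pc: "path_connected S" and hom: "\<And>p q. path p \<Longrightarrow> path_image p \<subseteq> S \<Longrightarrow> path q \<Longrightarrow>
      path_image q \<subseteq> S \<Longrightarrow> pathstart q = pathstart p \<Longrightarrow> pathfinish q = pathfinish p \<Longrightarrow>
      homotopic_paths S p q"
    using S unfolding simply_connected_eq_homotopic_paths by blast+
  define R where "R x v \<longleftrightarrow> (\<exists>p h. path p \<and> path_image p \<subseteq> S \<and> pathstart p = x0 \<and> pathfinish p = x \<and>
      primitive_along L {0..1} p h \<and> v = h 1 - h 0)" for x v
  have prim: "\<exists>h. primitive_along L {0..1} p h" if "path p" "path_image p \<subseteq> S" for p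
    using that by (intro primitive_along_exists[OF L \<open>open S\<close>]) (auto simp: path_def path_image_def)
  have ex: "\<exists>v. R x v" if x: "x \<in> S" for x
  proof -
    obtain p where p: "path p" "path_image p \<subseteq> S" "pathstart p = x0" "pathfinish p = x"
      using pc x0 x unfolding path_connected_def by blast
    then show ?thesis using prim[OF p(1,2)] unfolding R_def by blast
  qed
  have unique: "v = w" if "R x v" "R x w" for x v w
    using that primitive_along_homotopic_paths[OF L \<open>open S\<close> hom] unfolding R_def by metis
  \<comment> \<open>Inside a ball a path is prolonged by a segment, along which the continuation is \<open>L x\<close> itself.\<close>
  have extend: "R y (v + L x y)"
    if B: "ball c r \<subseteq> S" "x \<in> ball c r" "y \<in> ball c r" and "R x v" for c r x y v
  proof -
    obtain p h where p: "path p" "path_image p \<subseteq> S" "pathstart p = x0" "pathfinish p = x"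
        and h: "primitive_along L {0..1} p h" "v = h 1 - h 0"
      using \<open>R x v\<close> unfolding R_def by blast
    define q where "q = p +++ linepath x y"
    have cs: "closed_segment x y \<subseteq> ball c r" by (rule closed_segment_subset) (use B in auto)
    then have seg: "linepath x y t \<in> ball c r" if "t \<in> {0..1}" for t
      using that linepath_image_01[of x y] by blast
    have q: "path q" "path_image q \<subseteq> S" "pathstart q = x0" "pathfinish q = y"
      using p cs B(1) by (auto simp: q_def path_image_join)
    obtain k where k: "primitive_along L {0..1} q k" using prim[OF q(1,2)] by blast
    have "primitive_along L {0..1} p (k \<circ> (\<lambda>t. t / 2))"
      by (rule primitive_along_compose[OF k]) (auto simp: q_def joinpaths_def dist_real_def)
    from primitive_along_unique[OF _ this h(1), of 0 1] have 1: "k (1/2) - k 0 = v"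
      using h(2) by simp
    have "L x (linepath x y s') - L x (linepath x y s) = L (linepath x y s) (linepath x y s')"
      if "s \<in> {0..1}" "s' \<in> {0..1}" for s s'
      using local_cocycleD[OF L B(1,2) seg[OF that(1)] seg[OF that(2)]] by simp
    then have seg_prim: "primitive_along L {0..1} (linepath x y) (\<lambda>t. L x (linepath x y t))"
      unfolding primitive_along_def by (intro exI[of _ 1]) simp
    have "primitive_along L {0..1} (linepath x y) (k \<circ> (\<lambda>t. (1 + t) / 2))"
    proof (rule primitive_along_compose[OF k])
      show "q ((1 + s) / 2) = linepath x y s" if "s \<in> {0..1}" for s
      proof (cases "s = 0")
        case True
        then show ?thesis using p(4) by (simp add: q_def joinpaths_def pathfinish_def linepath_def)
      qed (use that in \<open>auto simp: q_def joinpaths_def add_divide_distrib\<close>)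
    qed (auto simp: dist_real_def abs_if field_simps)
    from primitive_along_unique[OF _ this, of "\<lambda>t. L x (linepath x y t)" 0 1]
    have "k 1 - k (1/2) = L x y - L x x"
      using seg_prim by (simp add: linepath_def)
    also have "L x x = 0" using local_cocycle_same[OF L \<open>open S\<close>] B by blast
    finally have "k 1 - k 0 = v + L x y" using 1 by simp
    then show ?thesis using q k unfolding R_def by metis
  qed
  define F where "F x = (SOME v. R x v)" for x
  have F: "R x (F x)" if "x \<in> S" for x unfolding F_def using ex[OF that] by (rule someI_ex)
  have "F y - F x = L x y" if B: "ball c r \<subseteq> S" "x \<in> ball c r" "y \<in> ball c r" for c r x y
  proof -
    have "x \<in> S" "y \<in> S" using B by auto
    then show ?thesis using unique[OF F extend[OF B F]] by force
  qed
  then show ?thesis by blast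
qed

section \<open>Potentials of closed vector fields\<close>

definition line_integral :: "('a::euclidean_space \<Rightarrow> 'a) \<Rightarrow> 'a \<Rightarrow> 'a \<Rightarrow> real" where
  "line_integral w x y = integral {0..1} (\<lambda>t. w (x + t *\<^sub>R (y - x)) \<bullet> (y - x))"

text \<open>Let \<open>Z\<close> run from \<open>y\<close> to \<open>z\<close> along the opposite side and let \<open>G s\<close> be the integral from \<open>x\<close> to \<open>Z s\<close>.
Differentiation under the integral sign and the symmetry of the derivative of \<open>w\<close> turn the \<open>s\<close>-derivative of
the integrand into the \<open>t\<close>-derivative of \<open>t * (w (P s t) \<bullet> v)\<close>.  Hence \<open>G\<close> has derivative \<open>w (Z s) \<bullet> v\<close>, whose
integral is the line integral from \<open>y\<close> to \<open>z\<close>.\<close>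

lemma line_integral_triangle:
  fixes w :: "'a::euclidean_space \<Rightarrow> 'a"
  assumes S: "convex S" "x \<in> S" "y \<in> S" "z \<in> S"
    and der: "\<And>x. x \<in> S \<Longrightarrow> (w has_derivative w' x) (at x)"
    and cont: "\<And>v. continuous_on S (\<lambda>x. w' x v)"
    and sym: "\<And>x u v. x \<in> S \<Longrightarrow> w' x u \<bullet> v = w' x v \<bullet> u"
  shows "line_integral w x y + line_integral w y z = line_integral w x z"
proof -
  define v where "v = z - y"
  define Z where "Z s = y + s *\<^sub>R v" for s :: real
  define P where "P s t = x + t *\<^sub>R (Z s - x)" for s t :: real
  define f where "f s t = w (P s t) \<bullet> (Z s - x)" for s t
  define f' where "f' s t = t * (w' (P s t) v \<bullet> (Z s - x)) + w (P s t) \<bullet> v" for s t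
  have ZS: "Z s \<in> S" if "s \<in> {0..1}" for s
  proof -
    have "Z s = (1 - s) *\<^sub>R y + s *\<^sub>R z" by (simp add: Z_def v_def algebra_simps)
    then show ?thesis using S that by (simp add: convexD_alt)
  qed
  have PS: "P s t \<in> S" if "s \<in> {0..1}" "t \<in> {0..1}" for s t
  proof -
    have "P s t = (1 - t) *\<^sub>R x + t *\<^sub>R Z s" by (simp add: P_def algebra_simps)
    then show ?thesis using S ZS that by (simp add: convexD_alt)
  qed
  have wcont: "continuous_on S w"
    using der has_derivative_continuous continuous_at_imp_continuous_on by blast
  have lin: "linear (w' x)" if "x \<in> S" for x using has_derivative_linear[OF der[OF that]] .
  have Pcont: "continuous_on ({0..1} \<times> {0..1}) (\<lambda>q. P (fst q) (snd q))"
    unfolding P_def Z_def by (intro continuous_intros)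
  have wPcont: "continuous_on ({0..1} \<times> {0..1}) (\<lambda>q. w (P (fst q) (snd q)))"
    by (rule continuous_on_compose2[OF wcont Pcont]) (auto intro: PS)
  have w'Pcont: "continuous_on ({0..1} \<times> {0..1}) (\<lambda>q. w' (P (fst q) (snd q)) v)"
    by (rule continuous_on_compose2[OF cont Pcont]) (auto intro: PS)
  have f'cont: "continuous_on ({0..1} \<times> {0..1}) (\<lambda>(s, t). f' s t)"
    unfolding f'_def split_beta Z_def by (intro continuous_intros wPcont w'Pcont)
  have fcont: "continuous_on {0..1} (f s)" if "s \<in> {0..1}" for s
  proof -
    have "continuous_on {0..1} (\<lambda>t. w (P s t))"
      by (rule continuous_on_compose2[OF wcont]) (auto simp: P_def[of s] intro!: continuous_intros PS[OF that, unfolded P_def])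
    then show ?thesis unfolding f_def by (intro continuous_intros)
  qed
  define G where "G s = integral {0..1} (f s)" for s
  have fder: "((\<lambda>s. f s t) has_field_derivative f' s t) (at s within {0..1})"
    if st: "s \<in> {0..1}" "t \<in> {0..1}" for s t
  proof -
    have Zd: "(Z has_derivative (\<lambda>h. h *\<^sub>R v)) (at s within {0..1})"
      unfolding Z_def by (auto intro!: derivative_eq_intros)
    have "((\<lambda>s. P s t) has_derivative (\<lambda>h. t *\<^sub>R h *\<^sub>R v)) (at s within {0..1})"
      unfolding P_def by (auto intro!: derivative_eq_intros Zd)
    from has_derivative_compose[OF this der[OF PS[OF st]]]
    have "((\<lambda>s. w (P s t)) has_derivative (\<lambda>h. w' (P s t) (t *\<^sub>R h *\<^sub>R v))) (at s within {0..1})" .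
    then have "((\<lambda>s. f s t) has_derivative
        (\<lambda>h. w (P s t) \<bullet> (h *\<^sub>R v) + w' (P s t) (t *\<^sub>R h *\<^sub>R v) \<bullet> (Z s - x))) (at s within {0..1})"
      unfolding f_def by (auto intro!: derivative_eq_intros Zd)
    moreover have "(\<lambda>h. w (P s t) \<bullet> (h *\<^sub>R v) + w' (P s t) (t *\<^sub>R h *\<^sub>R v) \<bullet> (Z s - x)) = (*) (f' s t)"
      using lin[OF PS[OF st]] by (auto simp: fun_eq_iff f'_def linear_cmul algebra_simps)
    ultimately show ?thesis by (simp add: has_field_derivative_def)
  qed
  \<comment> \<open>Symmetry enters here: it exchanges the roles of \<open>v\<close> and \<open>Z s - x\<close> and makes \<open>f' s\<close> an exact derivative in \<open>t\<close>.\<close>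
  have int_f': "integral {0..1} (f' s) = w (Z s) \<bullet> v" if s: "s \<in> {0..1}" for s
  proof -
    have "((\<lambda>t. t * (w (P s t) \<bullet> v)) has_vector_derivative f' s t) (at t within {0..1})"
      if t: "t \<in> {0..1}" for t
    proof -
      have "((\<lambda>t. P s t) has_derivative (\<lambda>h. h *\<^sub>R (Z s - x))) (at t within {0..1})"
        unfolding P_def by (auto intro!: derivative_eq_intros)
      from has_derivative_compose[OF this der[OF PS[OF s t]]]
      have "((\<lambda>t. w (P s t)) has_derivative (\<lambda>h. w' (P s t) (h *\<^sub>R (Z s - x)))) (at t within {0..1})" .
      then have "((\<lambda>t. t * (w (P s t) \<bullet> v)) has_derivative
          (\<lambda>h. t * (w' (P s t) (h *\<^sub>R (Z s - x)) \<bullet> v) + h * (w (P s t) \<bullet> v))) (at t within {0..1})"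
        by (auto intro!: derivative_eq_intros)
      moreover have "(\<lambda>h. t * (w' (P s t) (h *\<^sub>R (Z s - x)) \<bullet> v) + h * (w (P s t) \<bullet> v))
          = (\<lambda>h. h *\<^sub>R f' s t)"
        unfolding linear_cmul[OF lin[OF PS[OF s t]]] f'_def inner_scaleR_left
          sym[OF PS[OF s t], of "Z s - x" v]
        by (simp add: fun_eq_iff algebra_simps)
      ultimately show ?thesis by (simp add: has_vector_derivative_def)
    qed
    then have "(f' s has_integral 1 * (w (P s 1) \<bullet> v) - 0 * (w (P s 0) \<bullet> v)) {0..1}"
      by (intro fundamental_theorem_of_calculus) auto
    then show ?thesis by (auto simp: P_def dest: integral_unique)
  qed
  have "(G has_field_derivative integral {0..1} (f' s)) (at s within {0..1})"
    if s: "s \<in> {0..1}" for s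
    unfolding G_def
    by (rule leibniz_rule_field_derivative[of "{0..1}" 0 1 f f' s, unfolded cbox_interval])
      (insert s, simp_all add: fder integrable_continuous_interval[OF fcont] f'cont)
  then have "((\<lambda>s. w (Z s) \<bullet> v) has_integral G 1 - G 0) {0..1}"
    by (intro fundamental_theorem_of_calculus)
      (auto simp: int_f' simp flip: has_real_derivative_iff_has_vector_derivative)
  then have "integral {0..1} (\<lambda>s. w (Z s) \<bullet> v) = G 1 - G 0" by (rule integral_unique)
  moreover have "integral {0..1} (\<lambda>s. w (Z s) \<bullet> v) = line_integral w y z"
    by (simp add: line_integral_def Z_def v_def)
  moreover have "G 0 = line_integral w x y" "G 1 = line_integral w x z"
    by (simp_all add: G_def f_def[abs_def] P_def Z_def v_def line_integral_def)
  ultimately show ?thesis by simp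
qed

lemma has_derivative_line_integral:
  assumes r: "r > 0" and w: "continuous_on (ball x r) w"
    and F: "\<And>y. y \<in> ball x r \<Longrightarrow> F y - F x = line_integral w x y"
  shows "(F has_derivative (\<lambda>v. w x \<bullet> v)) (at x)"
  unfolding has_derivative_at_alt
proof (intro conjI allI impI)
  show "bounded_linear (\<lambda>v. w x \<bullet> v)" by (rule bounded_linear_inner_right)
  fix e :: real assume e: "e > 0"
  obtain d where d: "d > 0" "\<And>y. y \<in> ball x r \<Longrightarrow> dist y x < d \<Longrightarrow> dist (w y) (w x) < e"
    using w r e unfolding continuous_on_iff by (metis centre_in_ball)
  have "norm (F y - F x - w x \<bullet> (y - x)) \<le> e * norm (y - x)" if y: "norm (y - x) < min d r" for y
  proof -
    define P where "P t = x + t *\<^sub>R (y - x)" for t :: real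
    have P: "dist (P t) x \<le> norm (y - x)" if "t \<in> {0..1}" for t
      using that by (simp add: P_def dist_norm mult_left_le_one_le)
    then have PB: "P t \<in> ball x r" if "t \<in> {0..1}" for t
      using y that by (force simp: dist_commute)
    have "continuous_on {0..1} (\<lambda>t. w (P t))"
      by (rule continuous_on_compose2[OF w]) (use PB in \<open>auto simp: P_def intro!: continuous_intros\<close>)
    then have "(\<lambda>t. w (P t) \<bullet> (y - x)) integrable_on {0..1}"
      by (intro integrable_continuous_interval continuous_intros)
    moreover have "y \<in> ball x r" using y by (simp add: dist_norm norm_minus_commute)
    ultimately have "((\<lambda>t. w (P t) \<bullet> (y - x)) has_integral F y - F x) {0..1}"
      using F by (simp add: line_integral_def P_def integrable_integral)
    from has_integral_diff[OF this has_integral_const_real[of "w x \<bullet> (y - x)" 0 1]]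
    have I: "((\<lambda>t. (w (P t) - w x) \<bullet> (y - x)) has_integral F y - F x - w x \<bullet> (y - x)) (cbox 0 1)"
      by (simp add: inner_diff_left)
    have "norm (F y - F x - w x \<bullet> (y - x)) \<le> e * norm (y - x) * measure lborel (cbox 0 (1::real))"
    proof (rule has_integral_bound[OF _ I])
      fix t :: real assume "t \<in> cbox 0 1"
      then have t: "t \<in> {0..1}" by simp
      have "norm ((w (P t) - w x) \<bullet> (y - x)) \<le> norm (w (P t) - w x) * norm (y - x)"
        using Cauchy_Schwarz_ineq2 by simp
      also have "\<dots> \<le> e * norm (y - x)"
        using d(2)[OF PB[OF t]] P[OF t] y by (intro mult_right_mono) (auto simp: dist_norm)
      finally show "norm ((w (P t) - w x) \<bullet> (y - x)) \<le> e * norm (y - x)" .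
    qed (use e in simp)
    then show ?thesis by simp
  qed
  then show "\<exists>d>0. \<forall>y. norm (y - x) < d \<longrightarrow> norm (F y - F x - w x \<bullet> (y - x)) \<le> e * norm (y - x)"
    using d(1) r by (intro exI[of _ "min d r"]) simp
qed

text \<open>The Poincare lemma on simply connected sets: the line integrals over segments are a local cocycle by the triangle
lemma, and a function whose increments they are has \<open>w\<close> as its gradient.\<close>

theorem closed_field_has_potential:
  fixes w :: "'a::euclidean_space \<Rightarrow> 'a"
  assumes S: "open S" "simply_connected S"
    and der: "\<And>x. x \<in> S \<Longrightarrow> (w has_derivative w' x) (at x)"
    and cont: "\<And>v. continuous_on S (\<lambda>x. w' x v)"
    and sym: "\<And>x u v. x \<in> S \<Longrightarrow> w' x u \<bullet> v = w' x v \<bullet> u"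
  shows "\<exists>F. \<forall>x\<in>S. (F has_derivative (\<lambda>v. w x \<bullet> v)) (at x)"
proof -
  have "local_cocycle S (line_integral w)"
    unfolding local_cocycle_def
  proof (intro allI impI)
    fix c r x y z assume "ball c r \<subseteq> S" "{x, y, z} \<subseteq> ball c r"
    then show "line_integral w x y + line_integral w y z = line_integral w x z"
      by (intro line_integral_triangle[of "ball c r" _ _ _ w w'])
        (auto intro: der sym continuous_on_subset[OF cont])
  qed
  from simply_connected_cocycle_trivial[OF this S] obtain F where F:
      "\<And>c r x y. ball c r \<subseteq> S \<Longrightarrow> x \<in> ball c r \<Longrightarrow> y \<in> ball c r \<Longrightarrow> F y - F x = line_integral w x y"
    by blast
  have w: "continuous_on S w"
    using der has_derivative_continuous continuous_at_imp_continuous_on by blast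
  have "(F has_derivative (\<lambda>v. w x \<bullet> v)) (at x)" if "x \<in> S" for x
  proof -
    obtain r where r: "r > 0" "ball x r \<subseteq> S" using S(1) \<open>x \<in> S\<close> open_contains_ball by blast
    then show ?thesis using F[OF r(2)] continuous_on_subset[OF w r(2)]
      by (intro has_derivative_line_integral[OF r(1)]) auto
  qed
  then show ?thesis by blast
qed

section \<open>Calculus of smooth functions\<close>

lemma Ck_on_Suc_imp: "Ck_on (Suc k) f S \<Longrightarrow> Ck_on k f S"
proof (induction k arbitrary: f)
  case 0
  then show ?case
    by (auto intro!: continuous_at_imp_continuous_on differentiable_imp_continuous_within)
qed auto

lemma smooth_on_has_derivative:
  assumes "smooth_on f S" "x \<in> S"
  shows "(f has_derivative frechet_derivative f (at x)) (at x)"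
proof -
  have "Ck_on (Suc 0) f S" using assms(1) by (simp only: smooth_on_def)
  then show ?thesis using assms(2) frechet_derivative_works by auto
qed

text \<open>Lets a derivative be exhibited by any formula, which is how the closure properties below are obtained by
induction on the order of differentiability.\<close>

lemma Ck_on_SucI:
  assumes "open S" and der: "\<And>x. x \<in> S \<Longrightarrow> (f has_derivative f' x) (at x)"
    and "\<And>b. b \<in> Basis \<Longrightarrow> Ck_on k (\<lambda>x. f' x b) S"
  shows "Ck_on (Suc k) f S"
proof -
  have "frechet_derivative f (at x) = f' x" if "x \<in> S" for x
    using frechet_derivative_at[OF der[OF that]] by simp
  then have "Ck_on k (\<lambda>x. frechet_derivative f (at x) b) S" if "b \<in> Basis" for b
    using Ck_on_cong_open[OF assms(1) _ assms(3)[OF that]] by simp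
  then show ?thesis using der by (auto simp: differentiable_def)
qed

lemma Ck_on_Suc_has_derivative:
  "Ck_on (Suc k) f S \<Longrightarrow> x \<in> S \<Longrightarrow> (f has_derivative frechet_derivative f (at x)) (at x)"
  using frechet_derivative_works by auto

lemma Ck_on_const: "Ck_on k (\<lambda>x. c) S"
  by (induction k arbitrary: c) auto

lemma Ck_on_add:
  assumes "open S" "Ck_on k f S" "Ck_on k g S"
  shows "Ck_on k (\<lambda>x. f x + g x) S"
  using assms(2,3)
proof (induction k arbitrary: f g)
  case (Suc k)
  show ?case
    by (rule Ck_on_SucI[OF assms(1) has_derivative_add[OF Suc.prems[THEN Ck_on_Suc_has_derivative]]])
      (use Suc in auto)
qed (auto intro: continuous_intros)

lemma Ck_on_mult:
  assumes "open S" "Ck_on k f S" "Ck_on k g S"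
  shows "Ck_on k (\<lambda>x. f x * g x) S"
  using assms(2,3)
proof (induction k arbitrary: f g)
  case (Suc k)
  show ?case
    by (rule Ck_on_SucI[OF assms(1) has_derivative_mult[OF Suc.prems[THEN Ck_on_Suc_has_derivative]]])
      (use Suc.prems Suc.prems[THEN Ck_on_Suc_imp] in
        \<open>auto intro!: Ck_on_add[OF assms(1)] Suc.IH\<close>)
qed (auto intro: continuous_intros)

lemma Ck_on_inverse:
  assumes "open S" "Ck_on k f S" "\<And>x. x \<in> S \<Longrightarrow> f x \<noteq> 0"
  shows "Ck_on k (\<lambda>x. inverse (f x)) S"
  using assms(2)
proof (induction k)
  case (Suc k)
  have "((\<lambda>x. inverse (f x)) has_derivative
      (\<lambda>h. (- 1) * (inverse (f x) * frechet_derivative f (at x) h * inverse (f x)))) (at x)"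
    if "x \<in> S" for x
    using Deriv.has_derivative_inverse[OF assms(3)[OF that] Ck_on_Suc_has_derivative[OF Suc.prems that]]
    by simp
  then show ?case
  proof (rule Ck_on_SucI[OF assms(1)])
    fix b :: 'a assume "b \<in> Basis"
    then have "Ck_on k (\<lambda>x. frechet_derivative f (at x) b) S" using Suc.prems by simp
    moreover have "Ck_on k (\<lambda>x. inverse (f x)) S"
      using Suc.IH Ck_on_Suc_imp[OF Suc.prems] by blast
    ultimately show "Ck_on k (\<lambda>x. (- 1) *
        (inverse (f x) * frechet_derivative f (at x) b * inverse (f x))) S"
      by (intro Ck_on_mult[OF assms(1)] Ck_on_const)
  qed
qed (use assms(3) in \<open>auto intro!: continuous_intros\<close>)

lemma Ck_on_bounded_linear:
  assumes "open S" "bounded_linear f"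
  shows "Ck_on k f S"
proof (cases k)
  case 0
  then show ?thesis by (simp add: assms(2) linear_continuous_on)
next
  case (Suc j)
  show ?thesis unfolding Suc
    by (rule Ck_on_SucI[OF assms(1) bounded_linear_imp_has_derivative[OF assms(2)] Ck_on_const])
qed

lemma Ck_on_of_coordinate:
  fixes S :: "(real^'n::finite) set"
  assumes "open S" "Ck_on k f ((\<lambda>x. x $ i) ` S)"
  shows "Ck_on k (\<lambda>x. f (x $ i)) S"
  using assms(2)
proof (induction k arbitrary: f)
  case 0
  then have "continuous_on ((\<lambda>x. x $ i) ` S) f" by simp
  then show ?case unfolding Ck_on.simps
    by (rule continuous_on_compose2) (auto intro!: continuous_intros)
next
  case (Suc k)
  have "((\<lambda>x. f (x $ i)) has_derivative (\<lambda>h. h $ i * frechet_derivative f (at (x $ i)) 1)) (at x)"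
    if x: "x \<in> S" for x
  proof -
    have fd: "(f has_derivative frechet_derivative f (at (x $ i))) (at (x $ i))"
      using Ck_on_Suc_has_derivative[OF Suc.prems] x by blast
    have "((\<lambda>x. x $ i) has_derivative (\<lambda>h. h $ i)) (at x)"
      by (rule bounded_linear_imp_has_derivative[OF bounded_linear_vec_nth])
    from has_derivative_compose[OF this fd]
    have "((\<lambda>x. f (x $ i)) has_derivative (\<lambda>h. frechet_derivative f (at (x $ i)) (h $ i))) (at x)" .
    moreover have scale: "frechet_derivative f (at (x $ i)) t = t * frechet_derivative f (at (x $ i)) 1" for t
      using linear_cmul[OF has_derivative_linear[OF fd], of t 1] by simp
    have "(\<lambda>h. frechet_derivative f (at (x $ i)) (h $ i)) = (\<lambda>h. h $ i * frechet_derivative f (at (x $ i)) 1)"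
      by (rule ext) (rule scale)
    ultimately show ?thesis by (rule back_subst)
  qed
  then show ?case
  proof (rule Ck_on_SucI[OF assms(1)])
    fix b :: "real^'n"
    have "Ck_on k (\<lambda>t. frechet_derivative f (at t) 1) ((\<lambda>x. x $ i) ` S)" using Suc.prems by simp
    from Ck_on_mult[OF assms(1) Ck_on_const Suc.IH[OF this]]
    show "Ck_on k (\<lambda>x. b $ i * frechet_derivative f (at (x $ i)) 1) S" .
  qed
qed

lemma Ck_on_line:
  assumes S: "open S" and T: "open T" "\<And>t. t \<in> T \<Longrightarrow> p + t *\<^sub>R e \<in> S" and e: "e \<in> Basis"
    and "Ck_on k f S"
  shows "Ck_on k (\<lambda>t::real. f (p + t *\<^sub>R e)) T"
  using assms(5)
proof (induction k arbitrary: f)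
  case 0
  then have "continuous_on S f" by simp
  then show ?case unfolding Ck_on.simps
    by (rule continuous_on_compose2) (auto intro!: continuous_intros T(2))
next
  case (Suc k)
  have "((\<lambda>t. f (p + t *\<^sub>R e)) has_derivative
      (\<lambda>h. h * frechet_derivative f (at (p + t *\<^sub>R e)) e)) (at t)" if "t \<in> T" for t
  proof -
    have "((\<lambda>t. p + t *\<^sub>R e) has_derivative (\<lambda>h. h *\<^sub>R e)) (at t)"
      by (auto intro!: derivative_eq_intros)
    from has_derivative_compose[OF this Ck_on_Suc_has_derivative[OF Suc.prems T(2)[OF that]]]
    show ?thesis
      by (simp add: linear_cmul[OF has_derivative_linear[OF Ck_on_Suc_has_derivative[OF Suc.prems T(2)[OF that]]]])
  qed
  then show ?case
    by (rule Ck_on_SucI[OF T(1)]) (use Suc e in auto)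
qed

lemma smooth_on_subset: "smooth_on f S \<Longrightarrow> T \<subseteq> S \<Longrightarrow> smooth_on f T"
  unfolding smooth_on_def using Ck_on_subset by blast

lemma smooth_on_cong_open:
  "open T \<Longrightarrow> smooth_on f T \<Longrightarrow> (\<And>x. x \<in> T \<Longrightarrow> f x = g x) \<Longrightarrow> smooth_on g T"
  unfolding smooth_on_def using Ck_on_cong_open by blast

lemma smooth_on_local:
  assumes "\<And>x. x \<in> S \<Longrightarrow> \<exists>T. open T \<and> x \<in> T \<and> smooth_on f T"
  shows "smooth_on f S"
  unfolding smooth_on_def
proof (intro allI Ck_on_local)
  fix k x assume "x \<in> S"
  then obtain T where "open T" "x \<in> T" "smooth_on f T" using assms by blast
  then show "\<exists>T. open T \<and> x \<in> T \<and> Ck_on k f T" by (auto simp: smooth_on_def)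
qed

lemma smooth_on_const: "smooth_on (\<lambda>x. c) S"
  by (simp add: smooth_on_def Ck_on_const)

lemma smooth_on_add:
  "open S \<Longrightarrow> smooth_on f S \<Longrightarrow> smooth_on g S \<Longrightarrow> smooth_on (\<lambda>x. f x + g x) S"
  by (simp add: smooth_on_def Ck_on_add)

lemma smooth_on_mult:
  "open S \<Longrightarrow> smooth_on f S \<Longrightarrow> smooth_on g S \<Longrightarrow> smooth_on (\<lambda>x. f x * g x) S"
  by (simp add: smooth_on_def Ck_on_mult)

lemma smooth_on_diff:
  assumes "open S" "smooth_on f S" "smooth_on g S"
  shows "smooth_on (\<lambda>x. f x - g x) S"
  using smooth_on_add[OF assms(1,2) smooth_on_mult[OF assms(1) smooth_on_const[of "- 1"] assms(3)]]
  by simp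

lemma smooth_on_divide:
  assumes "open S" "smooth_on f S" "smooth_on g S" "\<And>x. x \<in> S \<Longrightarrow> g x \<noteq> 0"
  shows "smooth_on (\<lambda>x. f x / g x) S"
  using assms(2,3) unfolding smooth_on_def divide_inverse
  by (auto intro!: Ck_on_mult Ck_on_inverse assms(1,4))

lemma smooth_on_power: "open S \<Longrightarrow> smooth_on f S \<Longrightarrow> smooth_on (\<lambda>x. f x ^ n) S"
  by (induction n) (simp_all add: smooth_on_const smooth_on_mult)

lemma smooth_on_sum:
  "open S \<Longrightarrow> (\<And>i. i \<in> I \<Longrightarrow> smooth_on (f i) S) \<Longrightarrow> smooth_on (\<lambda>x. \<Sum>i\<in>I. f i x) S"
  by (induction I rule: infinite_finite_induct) (simp_all add: smooth_on_const smooth_on_add)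

lemma smooth_on_prod:
  "open S \<Longrightarrow> (\<And>i. i \<in> I \<Longrightarrow> smooth_on (f i) S) \<Longrightarrow> smooth_on (\<lambda>x. \<Prod>i\<in>I. f i x) S"
  by (induction I rule: infinite_finite_induct) (simp_all add: smooth_on_const smooth_on_mult)

lemma smooth_on_coordinate: "open S \<Longrightarrow> smooth_on (\<lambda>x. x $ i) S"
  by (simp add: smooth_on_def Ck_on_bounded_linear bounded_linear_vec_nth)

lemmas smooth_intros = smooth_on_const smooth_on_add smooth_on_diff smooth_on_mult smooth_on_power
  smooth_on_sum smooth_on_prod smooth_on_divide smooth_on_coordinate

text \<open>Used to see that a potential of a smooth field is smooth.\<close>

lemma smooth_onI_derivative:
  assumes "open S" and der: "\<And>x. x \<in> S \<Longrightarrow> (f has_derivative f' x) (at x)"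
    and "\<And>b. b \<in> Basis \<Longrightarrow> smooth_on (\<lambda>x. f' x b) S"
  shows "smooth_on f S"
proof -
  have "Ck_on (Suc k) f S" for k
    by (rule Ck_on_SucI[OF assms(1) der]) (use assms(3) in \<open>auto simp: smooth_on_def\<close>)
  then show ?thesis unfolding smooth_on_def using Ck_on_Suc_imp by blast
qed

section \<open>Partial derivatives and functions independent of a coordinate\<close>

lemma partial_eqI: "(f has_derivative f') (at x) \<Longrightarrow> partial \<mu> f x = f' (axis \<mu> 1)"
  unfolding partial_def using frechet_derivative_at by metis

lemma smooth_on_differentiable: "smooth_on f S \<Longrightarrow> x \<in> S \<Longrightarrow> f differentiable at x"
  using smooth_on_has_derivative differentiable_def by blast

lemma smooth_on_partial: "smooth_on f S \<Longrightarrow> smooth_on (partial \<mu> f) S"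
proof -
  assume f: "smooth_on f S"
  have "Ck_on k (partial \<mu> f) S" for k
  proof -
    have "Ck_on (Suc k) f S" using f by (simp only: smooth_on_def)
    then have "Ck_on k (\<lambda>x. frechet_derivative f (at x) (axis \<mu> 1)) S" by simp
    then show ?thesis by (simp add: partial_def[abs_def])
  qed
  then show ?thesis by (simp add: smooth_on_def)
qed

lemma partial_cong_open:
  assumes "open S" "x \<in> S" "\<And>y. y \<in> S \<Longrightarrow> f y = g y" "f differentiable at x"
  shows "partial \<mu> f x = partial \<mu> g x"
  unfolding partial_def using frechet_derivative_transform_within_open[OF assms(4,1,2,3)] by simp

lemma frechet_derivative_partial:
  assumes "f differentiable at x"
  shows "frechet_derivative f (at x) v = (\<Sum>\<mu>\<in>UNIV. v $ \<mu> * partial \<mu> f x)"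
proof -
  have lin: "linear (frechet_derivative f (at x))" using assms by (rule linear_frechet_derivative)
  have "frechet_derivative f (at x) v = frechet_derivative f (at x) (\<Sum>\<mu>\<in>UNIV. v $ \<mu> *\<^sub>R axis \<mu> 1)"
    by (simp add: basis_expansion flip: scalar_mult_eq_scaleR)
  then show ?thesis by (simp add: linear_sum[OF lin] linear_cmul[OF lin] partial_def)
qed

lemma partial_diff:
  assumes "f differentiable at x" "g differentiable at x"
  shows "partial \<mu> (\<lambda>x. f x - g x) x = partial \<mu> f x - partial \<mu> g x"
  using partial_eqI[OF has_derivative_diff[OF assms[unfolded frechet_derivative_works]]]
  by (simp add: partial_def)

lemma partial_sum:
  assumes "\<And>i. i \<in> I \<Longrightarrow> f i differentiable at x"
  shows "partial \<mu> (\<lambda>x. \<Sum>i\<in>I. f i x) x = (\<Sum>i\<in>I. partial \<mu> (f i) x)"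
  using partial_eqI[OF has_derivative_sum[OF assms[unfolded frechet_derivative_works]]]
  by (simp add: partial_def)

lemma partial_mult:
  assumes "f differentiable at x" "g differentiable at x"
  shows "partial \<mu> (\<lambda>x. f x * g x) x = f x * partial \<mu> g x + partial \<mu> f x * g x"
  using partial_eqI[OF has_derivative_mult[OF assms[unfolded frechet_derivative_works]]]
  by (simp add: partial_def)

lemma partial_coordinate_square:
  "partial \<mu> (\<lambda>x. (x $ \<nu>)\<^sup>2) x = (if \<mu> = \<nu> then 2 * x $ \<nu> else 0)"
proof -
  have "((\<lambda>x. x $ \<nu>) has_derivative (\<lambda>h. h $ \<nu>)) (at x)"
    by (rule bounded_linear_imp_has_derivative[OF bounded_linear_vec_nth])
  from partial_eqI[OF has_derivative_power[OF this, of 2]] show ?thesis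
    by (auto simp: axis_def)
qed

text \<open>Invariance under all translations in the direction \<open>\<mu>\<close>, required on the whole space.  Translations
commute with differentiation, so all partial derivatives inherit this form of independence.\<close>

definition independent_of :: "'n::finite \<Rightarrow> (real^'n \<Rightarrow> 'a) \<Rightarrow> bool" where
  "independent_of \<mu> f \<longleftrightarrow> (\<forall>x t. f (x + t *\<^sub>R axis \<mu> 1) = f x)"

lemma partial_independent:
  assumes "independent_of \<mu> f" "f differentiable at x"
  shows "partial \<mu> f x = 0"
proof -
  define f' where "f' = frechet_derivative f (at x)"
  have "((\<lambda>t::real. x + t *\<^sub>R axis \<mu> 1) has_derivative (\<lambda>h. h *\<^sub>R axis \<mu> 1)) (at 0)"
    by (auto intro!: derivative_eq_intros)
  from has_derivative_compose[OF this, of f f']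
  have "((\<lambda>t. f (x + t *\<^sub>R axis \<mu> 1)) has_derivative (\<lambda>h. f' (h *\<^sub>R axis \<mu> 1))) (at 0)"
    using assms(2) by (simp add: f'_def frechet_derivative_works)
  then have "((\<lambda>t::real. f x) has_derivative (\<lambda>h. f' (h *\<^sub>R axis \<mu> 1))) (at 0)"
    using assms(1) by (simp add: independent_of_def)
  from has_derivative_unique[OF this has_derivative_const] have "f' (1 *\<^sub>R axis \<mu> 1) = 0" by meson
  then show ?thesis by (simp add: partial_def f'_def)
qed

lemma independent_partial:
  assumes "independent_of \<mu> f"
  shows "independent_of \<mu> (partial \<nu> f)"
proof -
  have shift: "(f has_derivative f') (at x)" if "(f has_derivative f') (at (x + t *\<^sub>R axis \<mu> 1))"
    for f' x t
  proof -
    have "((\<lambda>y. y + t *\<^sub>R axis \<mu> 1) has_derivative (\<lambda>h. h)) (at x)"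
      by (auto intro!: derivative_eq_intros)
    from has_derivative_compose[OF this that] show ?thesis
      using assms by (simp add: independent_of_def)
  qed
  have "(f has_derivative f') (at (x + t *\<^sub>R axis \<mu> 1)) \<longleftrightarrow> (f has_derivative f') (at x)" for f' x t
    using shift[of f' x t] shift[of f' "x + t *\<^sub>R axis \<mu> 1" "- t"] by auto
  then show ?thesis by (simp add: independent_of_def partial_def frechet_derivative_def)
qed

text \<open>The coordinate form of the potential theorem: equality of the cross derivatives is the symmetry of the
total derivative of the field.\<close>

theorem closed_coefficients_have_potential:
  fixes S :: "(real^'n::finite) set"
  assumes S: "open S" "simply_connected S" and a: "\<And>\<mu>. smooth_on (a \<mu>) S"
    and closed: "\<And>x \<mu> \<nu>. x \<in> S \<Longrightarrow> \<mu> \<noteq> \<nu> \<Longrightarrow> partial \<mu> (a \<nu>) x = partial \<nu> (a \<mu>) x"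
  shows "\<exists>F. smooth_on F S \<and> (\<forall>x\<in>S. \<forall>\<mu>. partial \<mu> F x = a \<mu> x)"
proof -
  define w where "w x = (\<chi> \<mu>. a \<mu> x)" for x
  define w' where "w' x v = (\<chi> \<mu>. frechet_derivative (a \<mu>) (at x) v)" for x v
  have exp: "frechet_derivative (a \<mu>) (at x) v = (\<Sum>\<nu>\<in>UNIV. v $ \<nu> * partial \<nu> (a \<mu>) x)"
    if "x \<in> S" for x \<mu> v
    using frechet_derivative_partial smooth_on_differentiable[OF a that] by blast
  have "\<exists>F. \<forall>x\<in>S. (F has_derivative (\<lambda>v. w x \<bullet> v)) (at x)"
  proof (rule closed_field_has_potential[OF S])
    show "(w has_derivative w' x) (at x)" if "x \<in> S" for x
      unfolding has_derivative_componentwise_within[of w]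
    proof
      fix b :: "real^'n" assume "b \<in> Basis"
      then obtain \<mu> where b: "b = axis \<mu> 1" by (auto simp: Basis_vec_def)
      show "((\<lambda>x. w x \<bullet> b) has_derivative (\<lambda>v. w' x v \<bullet> b)) (at x)"
        using smooth_on_has_derivative[OF a that, of \<mu>] by (simp add: b w_def w'_def inner_axis)
    qed
    show "continuous_on S (\<lambda>x. w' x v)" for v
    proof -
      have "continuous_on S (partial \<nu> (a \<mu>))" for \<mu> \<nu>
        using smooth_on_partial[OF a, of \<nu> \<mu>] unfolding smooth_on_def by (metis Ck_on.simps(1))
      then have "continuous_on S (\<lambda>x. \<chi> \<mu>. \<Sum>\<nu>\<in>UNIV. v $ \<nu> * partial \<nu> (a \<mu>) x)"
        by (intro continuous_intros)
      then show ?thesis by (simp add: w'_def exp cong: continuous_on_cong)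
    qed
    show "w' x u \<bullet> v = w' x v \<bullet> u" if x: "x \<in> S" for x u v
    proof -
      have "w' x u \<bullet> v = (\<Sum>\<mu>\<in>UNIV. \<Sum>\<nu>\<in>UNIV. u $ \<nu> * partial \<nu> (a \<mu>) x * v $ \<mu>)"
        by (simp add: inner_vec_def w'_def exp[OF x] sum_distrib_right)
      also have "\<dots> = (\<Sum>\<mu>\<in>UNIV. \<Sum>\<nu>\<in>UNIV. u $ \<nu> * partial \<mu> (a \<nu>) x * v $ \<mu>)"
        using closed[OF x] by (intro sum.cong refl) (metis (full_types))
      also have "\<dots> = (\<Sum>\<nu>\<in>UNIV. \<Sum>\<mu>\<in>UNIV. u $ \<nu> * partial \<mu> (a \<nu>) x * v $ \<mu>)"
        by (rule sum.swap)
      also have "\<dots> = w' x v \<bullet> u"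
        by (simp add: inner_vec_def w'_def exp[OF x] sum_distrib_left ac_simps)
      finally show ?thesis .
    qed
  qed
  then obtain F where F: "\<And>x. x \<in> S \<Longrightarrow> (F has_derivative (\<lambda>v. w x \<bullet> v)) (at x)" by blast
  have "smooth_on F S"
  proof (rule smooth_onI_derivative[OF S(1) F])
    fix b :: "real^'n" assume "b \<in> Basis"
    then obtain \<mu> where "b = axis \<mu> 1" by (auto simp: Basis_vec_def)
    then show "smooth_on (\<lambda>x. w x \<bullet> b) S" using a by (simp add: w_def inner_axis)
  qed
  moreover have "partial \<mu> F x = a \<mu> x" if "x \<in> S" for x \<mu>
    using partial_eqI[OF F[OF that]] by (simp add: w_def inner_axis)
  ultimately show ?thesis by blast
qed

section \<open>Divided differences solve the system\<close>

text \<open>The divided difference of the data \<open>X \<mu> x\<close> at the nodes \<open>(x $ \<mu>)\<^sup>2\<close> with \<open>\<mu> \<in> A\<close>, up to the sign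
\<open>(-1) ^ (card A - 1)\<close> that comes from the order of the differences in the denominator.  Variable
node sets are needed for the recursion.\<close>

definition divided_difference :: "('n::finite \<Rightarrow> real^'n \<Rightarrow> real) \<Rightarrow> 'n set \<Rightarrow> real^'n \<Rightarrow> real" where
  "divided_difference X A x =
     (\<Sum>\<mu>\<in>A. X \<mu> x / (\<Prod>\<nu>\<in>A - {\<mu>}. (x $ \<nu>)\<^sup>2 - (x $ \<mu>)\<^sup>2))"

lemma potential_eq_divided_difference: "potential X = divided_difference X UNIV"
  by (simp add: fun_eq_iff potential_def divided_difference_def U_def)

lemma partial_fractions:
  fixes a b c d :: real
  assumes "a \<noteq> 0" "b \<noteq> 0" "c \<noteq> 0"
  shows "(a - b) * (d / (a * (b * c))) = d / (b * c) - d / (a * c)"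
  using assms by (simp add: field_simps)

text \<open>The terms of nodes other than \<open>\<mu>\<close> and \<open>\<nu>\<close> split by partial fractions, and the terms of \<open>\<mu>\<close> and \<open>\<nu>\<close> lose one
denominator; they each appear in only one of the two smaller divided differences.\<close>

lemma divided_difference_recursion:
  fixes X :: "'n::finite \<Rightarrow> real^'n \<Rightarrow> real"
  assumes "\<mu> \<in> A" "\<nu> \<in> A" "\<mu> \<noteq> \<nu>" and dist: "inj_on (\<lambda>\<kappa>. (x $ \<kappa>)\<^sup>2) A"
  shows "((x $ \<mu>)\<^sup>2 - (x $ \<nu>)\<^sup>2) * divided_difference X A x
      = divided_difference X (A - {\<mu>}) x - divided_difference X (A - {\<nu>}) x"
proof -
  define y where "y \<kappa> = (x $ \<kappa>)\<^sup>2" for \<kappa>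
  define C where "C = A - {\<mu>, \<nu>}"
  have A: "A = insert \<mu> (insert \<nu> C)" "A - {\<mu>} = insert \<nu> C" "A - {\<nu>} = insert \<mu> C"
      "\<mu> \<notin> C" "\<nu> \<notin> C" "finite C"
    using assms(1-3) by (auto simp: C_def)
  have neq: "y \<kappa> \<noteq> y \<sigma>" if "\<kappa> \<in> A" "\<sigma> \<in> A" "\<kappa> \<noteq> \<sigma>" for \<kappa> \<sigma>
    using dist that by (auto simp: inj_on_def y_def)
  have DD: "divided_difference X B x = (\<Sum>\<sigma>\<in>B. X \<sigma> x / (\<Prod>\<kappa>\<in>B - {\<sigma>}. y \<kappa> - y \<sigma>))" for B
    by (simp add: divided_difference_def y_def)
  have inner: "(y \<mu> - y \<nu>) * (X \<sigma> x / (\<Prod>\<kappa>\<in>A - {\<sigma>}. y \<kappa> - y \<sigma>))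
      = X \<sigma> x / (\<Prod>\<kappa>\<in>insert \<nu> C - {\<sigma>}. y \<kappa> - y \<sigma>) - X \<sigma> x / (\<Prod>\<kappa>\<in>insert \<mu> C - {\<sigma>}. y \<kappa> - y \<sigma>)"
    if l: "\<sigma> \<in> C" for \<sigma>
  proof -
    define P where "P = (\<Prod>\<kappa>\<in>C - {\<sigma>}. y \<kappa> - y \<sigma>)"
    have sets: "A - {\<sigma>} = insert \<mu> (insert \<nu> (C - {\<sigma>}))" "insert \<nu> C - {\<sigma>} = insert \<nu> (C - {\<sigma>})"
        "insert \<mu> C - {\<sigma>} = insert \<mu> (C - {\<sigma>})"
      using A l by auto
    have "P \<noteq> 0" using A(6) neq l by (auto simp: P_def C_def)
    moreover have "y \<mu> - y \<sigma> \<noteq> 0" "y \<nu> - y \<sigma> \<noteq> 0" using neq assms l by (auto simp: C_def)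
    ultimately have "(y \<mu> - y \<nu>) * (X \<sigma> x / ((y \<mu> - y \<sigma>) * ((y \<nu> - y \<sigma>) * P)))
        = X \<sigma> x / ((y \<nu> - y \<sigma>) * P) - X \<sigma> x / ((y \<mu> - y \<sigma>) * P)"
      using partial_fractions[of "y \<mu> - y \<sigma>" "y \<nu> - y \<sigma>" P "X \<sigma> x"] by simp
    then show ?thesis
      unfolding sets using A(4-6) assms(3) by (simp add: P_def[symmetric])
  qed
  have sets: "insert \<mu> C - {\<mu>} = C" "insert \<nu> C - {\<nu>} = C" "A - {\<mu>} = insert \<nu> C" "A - {\<nu>} = insert \<mu> C"
    using A by auto
  have "y \<mu> - y \<nu> \<noteq> 0" using neq assms by auto
  then have outer: "(y \<mu> - y \<nu>) * (X \<mu> x / (\<Prod>\<kappa>\<in>A - {\<mu>}. y \<kappa> - y \<mu>)) = - (X \<mu> x / (\<Prod>\<kappa>\<in>C. y \<kappa> - y \<mu>))"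
      "(y \<mu> - y \<nu>) * (X \<nu> x / (\<Prod>\<kappa>\<in>A - {\<nu>}. y \<kappa> - y \<nu>)) = X \<nu> x / (\<Prod>\<kappa>\<in>C. y \<kappa> - y \<nu>)"
    unfolding sets using A(4-6) by (auto simp: divide_simps algebra_simps)
  have sumA: "sum g A = g \<mu> + (g \<nu> + sum g C)" for g :: "'n \<Rightarrow> real"
    unfolding A(1) using A(4-6) assms(3) by simp
  have "(y \<mu> - y \<nu>) * divided_difference X A x
      = (\<Sum>\<sigma>\<in>A. (y \<mu> - y \<nu>) * (X \<sigma> x / (\<Prod>\<kappa>\<in>A - {\<sigma>}. y \<kappa> - y \<sigma>)))"
    unfolding DD by (rule sum_distrib_left)
  also have "\<dots> = X \<nu> x / (\<Prod>\<kappa>\<in>C. y \<kappa> - y \<nu>) - X \<mu> x / (\<Prod>\<kappa>\<in>C. y \<kappa> - y \<mu>)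
      + (\<Sum>\<sigma>\<in>C. (y \<mu> - y \<nu>) * (X \<sigma> x / (\<Prod>\<kappa>\<in>A - {\<sigma>}. y \<kappa> - y \<sigma>)))"
    unfolding sumA outer by simp
  also have "(\<Sum>\<sigma>\<in>C. (y \<mu> - y \<nu>) * (X \<sigma> x / (\<Prod>\<kappa>\<in>A - {\<sigma>}. y \<kappa> - y \<sigma>)))
      = (\<Sum>\<sigma>\<in>C. X \<sigma> x / (\<Prod>\<kappa>\<in>insert \<nu> C - {\<sigma>}. y \<kappa> - y \<sigma>))
      - (\<Sum>\<sigma>\<in>C. X \<sigma> x / (\<Prod>\<kappa>\<in>insert \<mu> C - {\<sigma>}. y \<kappa> - y \<sigma>))"
    unfolding sum_subtractf[symmetric] by (intro sum.cong refl inner)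
  finally show ?thesis
    unfolding sets DD using A(4-6) by (simp add: sets y_def)
qed

lemma smooth_on_divided_difference:
  fixes W :: "(real^'n::finite) set"
  assumes "open W" "\<And>\<mu>. \<mu> \<in> A \<Longrightarrow> smooth_on (X \<mu>) W"
    and "\<And>x. x \<in> W \<Longrightarrow> inj_on (\<lambda>\<kappa>. (x $ \<kappa>)\<^sup>2) A"
  shows "smooth_on (divided_difference X A) W"
  unfolding divided_difference_def[abs_def]
  by (intro smooth_intros assms(1,2)) (use assms(3) in \<open>auto simp: inj_on_def\<close>)

lemma independent_divided_difference:
  fixes \<xi> :: "'n::finite \<Rightarrow> real \<Rightarrow> real"
  assumes "\<mu> \<notin> A"
  shows "independent_of \<mu> (divided_difference (\<lambda>\<sigma> x. \<xi> \<sigma> (x $ \<sigma>)) A)"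
  unfolding independent_of_def
proof (intro allI)
  fix x :: "real^'n" and t :: real
  define x' where "x' = x + t *\<^sub>R axis \<mu> 1"
  have "x' $ \<kappa> = x $ \<kappa>" if "\<kappa> \<in> A" for \<kappa> using that assms by (auto simp: x'_def axis_def)
  then show "divided_difference (\<lambda>\<sigma> x. \<xi> \<sigma> (x $ \<sigma>)) A (x + t *\<^sub>R axis \<mu> 1)
      = divided_difference (\<lambda>\<sigma> x. \<xi> \<sigma> (x $ \<sigma>)) A x"
    unfolding x'_def[symmetric] divided_difference_def
    by (intro sum.cong prod.cong arg_cong2[where f = "(/)"]) auto
qed

text \<open>The \<open>\<nu>\<close>-derivative removes \<open>g\<close>; what remains is the \<open>\<nu>\<close>-derivative of \<open>f\<close>, which is still independent
of the coordinate \<open>\<mu>\<close>.\<close>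

lemma mixed_partial_of_independent:
  fixes f g :: "real^'n::finite \<Rightarrow> real"
  assumes "open W" "x \<in> W" "smooth_on f W" "smooth_on g W"
    and "independent_of \<mu> f" "independent_of \<nu> g"
  shows "partial \<mu> (partial \<nu> (\<lambda>x. f x - g x)) x = 0"
proof -
  note diff = smooth_on_differentiable
  have "partial \<nu> f y = partial \<nu> (\<lambda>x. f x - g x) y" if "y \<in> W" for y
    using partial_diff[OF diff[OF assms(3) that] diff[OF assms(4) that]]
      partial_independent[OF assms(6) diff[OF assms(4) that]] by simp
  then have "partial \<mu> (partial \<nu> f) x = partial \<mu> (partial \<nu> (\<lambda>x. f x - g x)) x"
    by (rule partial_cong_open[OF assms(1,2)]) (auto intro: diff[OF smooth_on_partial] assms(2,3))
  moreover have "partial \<mu> (partial \<nu> f) x = 0"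
    by (rule partial_independent[OF independent_partial[OF assms(5)] diff[OF smooth_on_partial]])
      (rule assms)+
  ultimately show ?thesis by simp
qed

text \<open>By the recursion, \<open>F = (y\<^sub>\<mu> - y\<^sub>\<nu>) D\<close> has vanishing mixed derivative.  Expanding this derivative by the product
rule gives the equation of the system for the gradient of \<open>D\<close>.\<close>

lemma divided_difference_solves:
  fixes W :: "(real^'n::finite) set" and \<xi> :: "'n \<Rightarrow> real \<Rightarrow> real"
  defines "D \<equiv> divided_difference (\<lambda>\<mu> x. \<xi> \<mu> (x $ \<mu>)) UNIV"
  assumes W: "open W" "p \<in> W" and \<xi>: "\<And>\<mu>. smooth_on (\<lambda>x. \<xi> \<mu> (x $ \<mu>)) W"
    and dist: "\<And>x. x \<in> W \<Longrightarrow> inj (\<lambda>\<kappa>. (x $ \<kappa>)\<^sup>2)" and "\<mu> \<noteq> \<nu>"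
  shows "partial \<mu> (partial \<nu> D) p
    = - 2 * ((p $ \<mu> * partial \<nu> D p - p $ \<nu> * partial \<mu> D p) / ((p $ \<mu>)\<^sup>2 - (p $ \<nu>)\<^sup>2))"
proof -
  let ?DD = "divided_difference (\<lambda>\<mu> x. \<xi> \<mu> (x $ \<mu>))"
  have DD: "smooth_on (?DD A) W" for A
    using inj_on_subset[OF dist] by (intro smooth_on_divided_difference W \<xi>) auto
  have D: "smooth_on D W" unfolding D_def by (rule DD)
  define F where "F x = ((x $ \<mu>)\<^sup>2 - (x $ \<nu>)\<^sup>2) * D x" for x
  have sq: "smooth_on (\<lambda>x. (x $ \<mu>)\<^sup>2 - (x $ \<nu>)\<^sup>2) W" by (intro smooth_intros W)
  have F: "smooth_on F W" unfolding F_def[abs_def] by (intro smooth_intros W D)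
  note diff = smooth_on_differentiable[OF _ _]
  have psq: "partial \<kappa> (\<lambda>x. (x $ \<mu>)\<^sup>2 - (x $ \<nu>)\<^sup>2) x
      = (if \<kappa> = \<mu> then 2 * x $ \<mu> else 0) - (if \<kappa> = \<nu> then 2 * x $ \<nu> else 0)" for \<kappa> x
    by (subst partial_diff)
      (auto simp: partial_coordinate_square intro!: smooth_on_differentiable[of _ UNIV] smooth_intros)
  have F_eq: "F x = ?DD (UNIV - {\<mu>}) x - ?DD (UNIV - {\<nu>}) x" if "x \<in> W" for x
    unfolding F_def D_def using dist[OF that] \<open>\<mu> \<noteq> \<nu>\<close> by (intro divided_difference_recursion) auto
  have "partial \<nu> F x = partial \<nu> (\<lambda>x. ?DD (UNIV - {\<mu>}) x - ?DD (UNIV - {\<nu>}) x) x" if "x \<in> W" for x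
    by (rule partial_cong_open[OF W(1) that]) (use F_eq diff[OF F that] in auto)
  then have "partial \<mu> (partial \<nu> F) p
      = partial \<mu> (partial \<nu> (\<lambda>x. ?DD (UNIV - {\<mu>}) x - ?DD (UNIV - {\<nu>}) x)) p"
    by (rule partial_cong_open[OF W]) (use diff[OF smooth_on_partial[OF F] W(2)] in auto)
  also have "\<dots> = 0"
    by (rule mixed_partial_of_independent[OF W DD DD]) (simp_all add: independent_divided_difference)
  finally have zero: "partial \<mu> (partial \<nu> F) p = 0" .
  have "partial \<nu> F x = ((x $ \<mu>)\<^sup>2 - (x $ \<nu>)\<^sup>2) * partial \<nu> D x - 2 * x $ \<nu> * D x" if "x \<in> W" for x
    unfolding F_def[abs_def] partial_mult[OF diff[OF sq that] diff[OF D that]] psq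
    using \<open>\<mu> \<noteq> \<nu>\<close> by simp
  then have "partial \<mu> (partial \<nu> F) p
      = partial \<mu> (\<lambda>x. ((x $ \<mu>)\<^sup>2 - (x $ \<nu>)\<^sup>2) * partial \<nu> D x - (2 * x $ \<nu>) * D x) p"
    by (rule partial_cong_open[OF W]) (use diff[OF smooth_on_partial[OF F] W(2)] in auto)
  also have "\<dots> = (p $ \<mu>)\<^sup>2 * partial \<mu> (partial \<nu> D) p - (p $ \<nu>)\<^sup>2 * partial \<mu> (partial \<nu> D) p
      + 2 * p $ \<mu> * partial \<nu> D p - 2 * p $ \<nu> * partial \<mu> D p"
  proof -
    have lin: "partial \<mu> (\<lambda>x. 2 * x $ \<nu>) p = 0"
      by (rule partial_independent)
        (use \<open>\<mu> \<noteq> \<nu>\<close> in \<open>auto simp: independent_of_def axis_def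
          intro!: smooth_on_differentiable[of _ UNIV] smooth_intros\<close>)
    have "(\<lambda>x. 2 * x $ \<nu>) differentiable at p"
      by (intro smooth_on_differentiable[of _ UNIV] smooth_intros) auto
    note lin_D = differentiable_mult[OF this diff[OF D W(2)]] partial_mult[OF this diff[OF D W(2)]]
    note sq_D = differentiable_mult[OF diff[OF sq W(2)] diff[OF smooth_on_partial[OF D] W(2)]]
      partial_mult[OF diff[OF sq W(2)] diff[OF smooth_on_partial[OF D] W(2)]]
    show ?thesis
      unfolding partial_diff[OF sq_D(1) lin_D(1)] sq_D(2) lin_D(2) lin psq
      using \<open>\<mu> \<noteq> \<nu>\<close> by (simp add: algebra_simps)
  qed
  finally have "((p $ \<mu>)\<^sup>2 - (p $ \<nu>)\<^sup>2) * partial \<mu> (partial \<nu> D) p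
      = - 2 * (p $ \<mu> * partial \<nu> D p - p $ \<nu> * partial \<mu> D p)"
    using zero by (simp add: algebra_simps)
  moreover have "(p $ \<mu>)\<^sup>2 - (p $ \<nu>)\<^sup>2 \<noteq> 0"
    using injD[OF dist[OF W(2)]] \<open>\<mu> \<noteq> \<nu>\<close> by auto
  ultimately show ?thesis by (simp add: field_simps)
qed

text \<open>Near each point the functions \<open>X \<mu>\<close> are replaced by functions \<open>\<xi> \<mu>\<close> of one variable.  These are total functions
on the reals, so that the divided differences formed with them are independent of missing coordinates
everywhere and not just near the point.\<close>

lemma potential_form_imp_solution:
  fixes \<Omega> :: "(real^'n::finite) set"
  assumes "open \<Omega>" and dist: "\<And>x. x \<in> \<Omega> \<Longrightarrow> inj (\<lambda>\<kappa>. (x $ \<kappa>)\<^sup>2)"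
    and d: "has_potential_form \<Omega> d"
  shows "solves_system \<Omega> d"
proof -
  obtain X where X: "\<And>\<mu>. smooth_coordinate_function \<Omega> \<mu> (X \<mu>)"
      "\<And>\<mu> x. x \<in> \<Omega> \<Longrightarrow> d \<mu> x = partial \<mu> (potential X) x"
    using d unfolding has_potential_form_def by blast
  define local_potential where "local_potential p W D \<longleftrightarrow>
      open W \<and> p \<in> W \<and> smooth_on D W \<and> (\<forall>\<mu>. \<forall>x\<in>W. d \<mu> x = partial \<mu> D x) \<and>
      (\<forall>\<mu> \<nu>. \<mu> \<noteq> \<nu> \<longrightarrow> partial \<mu> (partial \<nu> D) p
        = - 2 * ((p $ \<mu> * partial \<nu> D p - p $ \<nu> * partial \<mu> D p) / ((p $ \<mu>)\<^sup>2 - (p $ \<nu>)\<^sup>2)))"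
    for p W D
  have local: "\<exists>W D. local_potential p W D" if p: "p \<in> \<Omega>" for p
  proof -
    have "\<exists>V \<xi>. open V \<and> p \<in> V \<and> V \<subseteq> \<Omega> \<and> smooth_on \<xi> ((\<lambda>x. x $ \<mu>) ` V) \<and> (\<forall>x\<in>V. X \<mu> x = \<xi> (x $ \<mu>))"
      for \<mu> using X(1) p unfolding smooth_coordinate_function_def by blast
    then obtain V \<xi> where V: "\<And>\<mu>. open (V \<mu>)" "\<And>\<mu>. p \<in> V \<mu>" "\<And>\<mu>. V \<mu> \<subseteq> \<Omega>"
        "\<And>\<mu>. smooth_on (\<xi> \<mu>) ((\<lambda>x. x $ \<mu>) ` V \<mu>)" "\<And>\<mu> x. x \<in> V \<mu> \<Longrightarrow> X \<mu> x = \<xi> \<mu> (x $ \<mu>)"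
      by metis
    define W where "W = (\<Inter>\<mu>. V \<mu>)"
    define D where "D = divided_difference (\<lambda>\<mu> x. \<xi> \<mu> (x $ \<mu>)) UNIV"
    have W: "open W" "p \<in> W" "W \<subseteq> \<Omega>" using V(1,2) V(3)[of undefined] by (auto simp: W_def)
    have \<xi>: "smooth_on (\<lambda>x. \<xi> \<mu> (x $ \<mu>)) W" for \<mu>
    proof -
      have "(\<lambda>x. x $ \<mu>) ` W \<subseteq> (\<lambda>x. x $ \<mu>) ` V \<mu>" by (auto simp: W_def)
      from smooth_on_subset[OF V(4) this] show ?thesis
        unfolding smooth_on_def using Ck_on_of_coordinate[OF W(1)] by blast
    qed
    have inj: "\<And>x. x \<in> W \<Longrightarrow> inj (\<lambda>\<kappa>. (x $ \<kappa>)\<^sup>2)" using W(3) dist by blast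
    have D: "smooth_on D W"
      unfolding D_def by (intro smooth_on_divided_difference W \<xi> inj)
    have "D x = potential X x" if "x \<in> W" for x
      using V(5)[of x] that
      by (simp add: D_def W_def potential_eq_divided_difference divided_difference_def)
    then have "partial \<mu> D x = partial \<mu> (potential X) x" if "x \<in> W" for \<mu> x
      by (rule partial_cong_open[OF W(1) that]) (use smooth_on_differentiable[OF D that] in auto)
    then have "d \<mu> x = partial \<mu> D x" if "x \<in> W" for \<mu> x
      using X(2) W(3) that by auto
    moreover have "\<forall>\<mu> \<nu>. \<mu> \<noteq> \<nu> \<longrightarrow> partial \<mu> (partial \<nu> D) p
        = - 2 * ((p $ \<mu> * partial \<nu> D p - p $ \<nu> * partial \<mu> D p) / ((p $ \<mu>)\<^sup>2 - (p $ \<nu>)\<^sup>2))"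
      unfolding D_def by (intro allI impI divided_difference_solves[OF W(1,2) \<xi> inj])
    ultimately have "local_potential p W D" using W(1,2) D by (simp add: local_potential_def)
    then show ?thesis by blast
  qed
  have "smooth_on (d \<mu>) \<Omega>" for \<mu>
  proof -
    have "\<exists>W. open W \<and> p \<in> W \<and> smooth_on (d \<mu>) W" if p: "p \<in> \<Omega>" for p
    proof -
      obtain W D where "local_potential p W D" using local[OF p] by blast
      then have W: "open W" "p \<in> W" "smooth_on D W" "\<forall>\<mu>. \<forall>x\<in>W. d \<mu> x = partial \<mu> D x"
        by (simp_all add: local_potential_def)
      have "smooth_on (d \<mu>) W"
        by (rule smooth_on_cong_open[OF W(1) smooth_on_partial[OF W(3), of \<mu>]]) (use W(4) in auto)
      then show ?thesis using W(1,2) by blast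
    qed
    then show ?thesis by (rule smooth_on_local)
  qed
  moreover have "partial \<mu> (d \<nu>) p
      = - 2 * ((p $ \<mu> * d \<nu> p - p $ \<nu> * d \<mu> p) / ((p $ \<mu>)\<^sup>2 - (p $ \<nu>)\<^sup>2))"
    if p: "p \<in> \<Omega>" and "\<mu> \<noteq> \<nu>" for p \<mu> \<nu>
  proof -
    obtain W D where WD: "local_potential p W D" using local[OF p] by blast
    then have W: "open W" "p \<in> W" "smooth_on D W" "\<And>\<mu> x. x \<in> W \<Longrightarrow> d \<mu> x = partial \<mu> D x"
      by (simp_all add: local_potential_def)
    have eq: "partial \<mu> (partial \<nu> D) p
        = - 2 * ((p $ \<mu> * partial \<nu> D p - p $ \<nu> * partial \<mu> D p) / ((p $ \<mu>)\<^sup>2 - (p $ \<nu>)\<^sup>2))"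
      using WD \<open>\<mu> \<noteq> \<nu>\<close> by (simp add: local_potential_def)
    have "partial \<mu> (d \<nu>) p = partial \<mu> (partial \<nu> D) p"
      by (rule partial_cong_open[OF W(1,2), symmetric])
        (use W(4) smooth_on_differentiable[OF smooth_on_partial[OF W(3)] W(2)] in auto)
    then show ?thesis using eq W(4)[OF W(2)] by simp
  qed
  ultimately show ?thesis unfolding solves_system_def by blast
qed

section \<open>Interpolation at finitely many nodes\<close>

text \<open>The factors are \<open>y \<nu> - t\<close> rather than \<open>t - y \<nu>\<close>, so that the value at \<open>y \<mu>\<close> of the product over all \<open>\<nu> \<noteq> \<mu>\<close>
is \<open>U\<^sub>\<mu>\<close> with its sign.\<close>

definition nodal_poly :: "('i \<Rightarrow> real) \<Rightarrow> 'i set \<Rightarrow> real poly" where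
  "nodal_poly y A = (\<Prod>\<nu>\<in>A. [:y \<nu>, - 1:])"

lemma poly_nodal_poly: "poly (nodal_poly y A) t = (\<Prod>\<nu>\<in>A. y \<nu> - t)"
  by (simp add: nodal_poly_def poly_prod)

lemma poly_eq_sum_upto:
  fixes p :: "real poly"
  assumes "degree p \<le> n"
  shows "poly p t = (\<Sum>k\<le>n. coeff p k * t ^ k)"
  unfolding poly_altdef using assms
  by (intro sum.mono_neutral_left) (auto simp: coeff_eq_0)

lemma degree_nodal_poly: "degree (nodal_poly y A) \<le> card A"
proof (cases "finite A")
  case True
  have "degree (nodal_poly y A) \<le> sum (degree \<circ> (\<lambda>\<nu>. [:y \<nu>, - 1:])) A"
    unfolding nodal_poly_def using True by (rule degree_prod_sum_le)
  then show ?thesis by simp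
qed (simp add: nodal_poly_def)

lemma coeff_nodal_poly_insert:
  assumes "finite A" "\<nu> \<notin> A"
  shows "coeff (nodal_poly y (insert \<nu> A)) k = y \<nu> * coeff (nodal_poly y A) k
    - (case k of 0 \<Rightarrow> 0 | Suc j \<Rightarrow> coeff (nodal_poly y A) j)"
  using assms by (simp add: nodal_poly_def coeff_pCons split: nat.split)

lemma coeff_nodal_poly_card:
  "finite A \<Longrightarrow> coeff (nodal_poly y A) (card A) = (- 1) ^ card A"
proof (induction rule: finite_induct)
  case (insert \<nu> A)
  have "coeff (nodal_poly y A) (Suc (card A)) = 0"
    using degree_nodal_poly[of y A] by (intro coeff_eq_0) simp
  then show ?case using insert by (simp add: coeff_nodal_poly_insert)
qed (simp add: nodal_poly_def)

text \<open>Lagrange interpolation of \<open>t ^ k\<close> at the nodes \<open>y \<mu>\<close> reproduces \<open>t ^ k\<close>, both sides having degree less than the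
number of nodes.  The sum is \<open>(-1) ^ (card I - 1)\<close> times the coefficient of \<open>t ^ (card I - 1)\<close> in the interpolation
polynomial.\<close>

lemma sum_powers_div_nodal:
  fixes y :: "'i \<Rightarrow> real"
  assumes I: "finite I" "inj_on y I" and k: "k < card I"
  shows "(\<Sum>\<mu>\<in>I. y \<mu> ^ k / (\<Prod>\<nu>\<in>I - {\<mu>}. y \<nu> - y \<mu>))
    = (if k = card I - 1 then (- 1) ^ (card I - 1) else 0)"
proof -
  define n where "n = card I - 1"
  define c where "c \<mu> = y \<mu> ^ k / (\<Prod>\<nu>\<in>I - {\<mu>}. y \<nu> - y \<mu>)" for \<mu>
  define p where "p = (\<Sum>\<mu>\<in>I. smult (c \<mu>) (nodal_poly y (I - {\<mu>})))"
  have card: "card (I - {\<mu>}) = n" if "\<mu> \<in> I" for \<mu> using I(1) that by (simp add: n_def)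
  have "poly p (y \<sigma>) = y \<sigma> ^ k" if s: "\<sigma> \<in> I" for \<sigma>
  proof -
    have "c \<mu> * poly (nodal_poly y (I - {\<mu>})) (y \<sigma>) = (if \<mu> = \<sigma> then y \<sigma> ^ k else 0)"
      if "\<mu> \<in> I" for \<mu>
    proof (cases "\<mu> = \<sigma>")
      case True
      have "(\<Prod>\<nu>\<in>I - {\<mu>}. y \<nu> - y \<mu>) \<noteq> 0" using I that by (auto simp: inj_on_def)
      then show ?thesis using True by (simp add: c_def poly_nodal_poly)
    next
      case False
      then have "(\<Prod>\<nu>\<in>I - {\<mu>}. y \<nu> - y \<sigma>) = 0" using I(1) s by (intro prod_zero) auto
      then show ?thesis using False by (simp add: poly_nodal_poly)
    qed
    then have "poly p (y \<sigma>) = (\<Sum>\<mu>\<in>I. if \<mu> = \<sigma> then y \<sigma> ^ k else 0)"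
      by (simp add: p_def poly_sum cong: sum.cong)
    then show ?thesis using I(1) s by simp
  qed
  then have "p = monom 1 k"
  proof (intro poly_eqI_degree[of "y ` I"])
    have "degree (nodal_poly y (I - {\<mu>})) \<le> n" if "\<mu> \<in> I" for \<mu>
      using degree_nodal_poly[of y "I - {\<mu>}"] unfolding card[OF that] .
    then have "degree p \<le> n"
      unfolding p_def by (intro degree_sum_le order_trans[OF degree_smult_le] I(1))
    then show "degree p < card (y ` I)" using k by (simp add: card_image[OF I(2)] n_def)
    show "degree (monom (1::real) k) < card (y ` I)"
      using k degree_monom_le[of "1::real" k] by (simp add: card_image[OF I(2)])
  qed (auto simp: poly_monom)
  moreover have "coeff p n = (\<Sum>\<mu>\<in>I. c \<mu> * (- 1) ^ n)"
  proof -
    have "coeff (nodal_poly y (I - {\<mu>})) n = (- 1) ^ n" if "\<mu> \<in> I" for \<mu>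
      using coeff_nodal_poly_card[of "I - {\<mu>}" y] I(1) unfolding card[OF that] by simp
    then show ?thesis by (simp add: p_def coeff_sum)
  qed
  ultimately have "(\<Sum>\<mu>\<in>I. c \<mu>) * (- 1) ^ n = (if k = n then 1 else 0)"
    by (simp add: sum_distrib_right)
  note leading = this
  have "(\<Sum>\<mu>\<in>I. c \<mu>) = (\<Sum>\<mu>\<in>I. c \<mu>) * (- 1) ^ n * (- 1) ^ n"
    by (simp add: mult.assoc flip: power_mult_distrib)
  also have "\<dots> = (if k = n then (- 1) ^ n else 0)" unfolding leading by simp
  finally show ?thesis by (simp only: c_def n_def)
qed

section \<open>Solutions come from an interpolation polynomial\<close>

abbreviation sq :: "real^'n::finite \<Rightarrow> 'n \<Rightarrow> real" where
  "sq x \<equiv> (\<lambda>\<nu>. (x $ \<nu>)\<^sup>2)"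

lemma smooth_on_coeff_nodal_poly:
  fixes S :: "(real^'n::finite) set"
  assumes "open S"
  shows "smooth_on (\<lambda>x. coeff (nodal_poly (sq x) A) k) S"
proof -
  have "finite A" by simp
  then show ?thesis
  proof (induction A arbitrary: k rule: finite_induct)
    case empty
    then show ?case by (simp add: nodal_poly_def smooth_on_const)
  next
    case (insert \<nu> A)
    then show ?case
      by (cases k) (simp_all add: coeff_nodal_poly_insert smooth_intros assms)
  qed
qed

lemma independent_nodal_poly:
  assumes "\<mu> \<notin> A"
  shows "independent_of \<mu> (\<lambda>x. f (nodal_poly (sq x) A))"
proof -
  have "nodal_poly (sq (x + t *\<^sub>R axis \<mu> 1)) A = nodal_poly (sq x) A" for x and t :: real
    unfolding nodal_poly_def using assms by (intro prod.cong) (auto simp: axis_def)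
  then show ?thesis by (simp add: independent_of_def)
qed

text \<open>Writing \<open>c\<close> and \<open>c'\<close> for consecutive coefficients of the product over the nodes other than \<open>\<mu>\<close> and \<open>\<nu>\<close>, and \<open>P\<close> for
the common value of \<open>\<partial>\<^sub>\<mu> d\<^sub>\<nu>\<close> and \<open>\<partial>\<^sub>\<nu> d\<^sub>\<mu>\<close>, the difference of the two cross derivatives is
\<open>c * (P * (y\<^sub>\<mu> - y\<^sub>\<nu>) + 2 * (x\<^sub>\<mu> d\<^sub>\<nu> - x\<^sub>\<nu> d\<^sub>\<mu>))\<close>, and the system says that the second factor is zero.\<close>

lemma solution_coefficients_closed:
  fixes x :: "real^'n::finite" and k :: nat
  assumes "open \<Omega>" "x \<in> \<Omega>" and dist: "inj (\<lambda>\<kappa>. (x $ \<kappa>)\<^sup>2)"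
    and d: "solves_system \<Omega> d" and "\<mu> \<noteq> \<nu>"
  defines "a \<equiv> \<lambda>\<mu> x. d \<mu> x * coeff (nodal_poly (sq x) (UNIV - {\<mu>})) k"
  shows "partial \<mu> (a \<nu>) x = partial \<nu> (a \<mu>) x"
proof -
  define C where "C = UNIV - {\<mu>, \<nu>}"
  define c where "c x = coeff (nodal_poly (sq x) C) k" for x
  define c' where "c' x = (case k of 0 \<Rightarrow> 0 | Suc j \<Rightarrow> coeff (nodal_poly (sq x) C) j)" for x
  have smooth: "smooth_on (d \<kappa>) \<Omega>" "smooth_on c \<Omega>" "smooth_on c' \<Omega>" for \<kappa>
    using d smooth_on_coeff_nodal_poly[OF assms(1)]
    by (cases k; auto simp: solves_system_def c_def[abs_def] c'_def[abs_def] smooth_on_const)+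
  note diff = smooth_on_differentiable[OF _ assms(2)]
  have ders: "partial \<alpha> (a \<beta>) x = partial \<alpha> (d \<beta>) x * ((x $ \<alpha>)\<^sup>2 * c x - c' x) + d \<beta> x * (2 * x $ \<alpha> * c x)"
    if ab: "\<alpha> \<noteq> \<beta>" "{\<alpha>, \<beta>} = {\<mu>, \<nu>}" for \<alpha> \<beta>
  proof -
    have "UNIV - {\<beta>} = insert \<alpha> C" "\<alpha> \<notin> C" using ab by (auto simp: C_def)
    then have a: "a \<beta> = (\<lambda>x. d \<beta> x * ((x $ \<alpha>)\<^sup>2 * c x - c' x))"
      by (simp add: a_def c_def c'_def coeff_nodal_poly_insert)
    have indep: "independent_of \<alpha> c" "independent_of \<alpha> c'"
      using independent_nodal_poly[OF \<open>\<alpha> \<notin> C\<close>, of "\<lambda>p. coeff p k"]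
        independent_nodal_poly[OF \<open>\<alpha> \<notin> C\<close>, of "\<lambda>p. case k of 0 \<Rightarrow> 0 | Suc j \<Rightarrow> coeff p j"]
      by (simp_all add: c_def[abs_def] c'_def[abs_def])
    have s: "smooth_on (\<lambda>x. (x $ \<alpha>)\<^sup>2) \<Omega>" by (intro smooth_intros assms(1))
    have sc: "smooth_on (\<lambda>x. (x $ \<alpha>)\<^sup>2 * c x) \<Omega>" by (intro smooth_on_mult s smooth assms(1))
    have scc: "smooth_on (\<lambda>x. (x $ \<alpha>)\<^sup>2 * c x - c' x) \<Omega>" by (intro smooth_on_diff sc smooth assms(1))
    show ?thesis
      unfolding a partial_mult[OF diff[OF smooth(1)] diff[OF scc]]
        partial_diff[OF diff[OF sc] diff[OF smooth(3)]] partial_mult[OF diff[OF s] diff[OF smooth(2)]]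
        partial_independent[OF indep(1) diff[OF smooth(2)]]
        partial_independent[OF indep(2) diff[OF smooth(3)]]
      by (simp add: partial_coordinate_square)
  qed
  define P where "P = - 2 * ((x $ \<mu> * d \<nu> x - x $ \<nu> * d \<mu> x) / ((x $ \<mu>)\<^sup>2 - (x $ \<nu>)\<^sup>2))"
  have neq: "(x $ \<mu>)\<^sup>2 - (x $ \<nu>)\<^sup>2 \<noteq> 0" using injD[OF dist, of \<mu> \<nu>] \<open>\<mu> \<noteq> \<nu>\<close> by auto
  then have P: "P * ((x $ \<mu>)\<^sup>2 - (x $ \<nu>)\<^sup>2) = - 2 * (x $ \<mu> * d \<nu> x - x $ \<nu> * d \<mu> x)"
    by (simp add: P_def)
  have 1: "partial \<mu> (d \<nu>) x = P" using d assms(2) \<open>\<mu> \<noteq> \<nu>\<close> by (simp add: solves_system_def P_def)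
  have "partial \<nu> (d \<mu>) x = - 2 * ((x $ \<nu> * d \<mu> x - x $ \<mu> * d \<nu> x) / ((x $ \<nu>)\<^sup>2 - (x $ \<mu>)\<^sup>2))"
    using d assms(2) \<open>\<mu> \<noteq> \<nu>\<close> by (simp add: solves_system_def)
  also have "\<dots> = P" using neq by (simp add: P_def divide_simps) (simp add: algebra_simps)
  finally have 2: "partial \<nu> (d \<mu>) x = P" .
  have "partial \<mu> (a \<nu>) x - partial \<nu> (a \<mu>) x
      = c x * (P * ((x $ \<mu>)\<^sup>2 - (x $ \<nu>)\<^sup>2) + 2 * (x $ \<mu> * d \<nu> x - x $ \<nu> * d \<mu> x))"
    using ders[of \<mu> \<nu>] ders[of \<nu> \<mu>] \<open>\<mu> \<noteq> \<nu>\<close> by (simp add: 1 2 insert_commute algebra_simps)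
  also have "\<dots> = 0" by (simp add: P)
  finally show ?thesis by simp
qed

text \<open>In a ball around \<open>p\<close> a point is joined by a segment inside the ball to its projection on the line through
\<open>p\<close> in direction \<open>\<mu>\<close>.  The coordinate \<open>\<mu>\<close> does not change on the segment, so \<open>X\<close> is constant there and is determined
by its values on the line.\<close>

lemma smooth_coordinate_function_if_partials_vanish:
  fixes \<Omega> :: "(real^'n::finite) set"
  assumes "open \<Omega>" and X: "smooth_on X \<Omega>"
    and zero: "\<And>\<nu> x. \<nu> \<noteq> \<mu> \<Longrightarrow> x \<in> \<Omega> \<Longrightarrow> partial \<nu> X x = 0"
  shows "smooth_coordinate_function \<Omega> \<mu> X"
  unfolding smooth_coordinate_function_def
proof
  fix p assume "p \<in> \<Omega>"
  then obtain r where r: "r > 0" "ball p r \<subseteq> \<Omega>" using assms(1) open_contains_ball by blast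
  define W where "W = ball p r"
  define \<xi> where "\<xi> t = X (p + (t - p $ \<mu>) *\<^sub>R axis \<mu> 1)" for t
  define proj where "proj x = p + (x $ \<mu> - p $ \<mu>) *\<^sub>R axis \<mu> 1" for x
  have proj: "proj x \<in> W" if "x \<in> W" for x
  proof -
    have "dist p (proj x) = \<bar>(x - p) $ \<mu>\<bar>" by (simp add: proj_def dist_norm norm_axis_1)
    also have "\<dots> \<le> dist p x" using component_le_norm_cart[of "x - p" \<mu>] by (simp add: dist_norm norm_minus_commute)
    finally show ?thesis using that by (simp add: W_def)
  qed
  have "X x = X (proj x)" if x: "x \<in> W" for x
  proof -
    define v where "v = x - proj x"
    have v: "v $ \<mu> = 0" by (simp add: v_def proj_def)
    have seg: "proj x + t *\<^sub>R v \<in> \<Omega>" if "t \<in> {0..1}" for t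
    proof -
      have "proj x + t *\<^sub>R v = (1 - t) *\<^sub>R proj x + t *\<^sub>R x" by (simp add: v_def algebra_simps)
      moreover have "convex W" by (simp add: W_def)
      ultimately have "proj x + t *\<^sub>R v \<in> W" using proj[OF x] x that by (simp add: convexD_alt)
      then show ?thesis using r(2) by (auto simp: W_def)
    qed
    have "((\<lambda>t. X (proj x + t *\<^sub>R v)) has_derivative (\<lambda>h. 0)) (at t within {0..1})" if t: "t \<in> {0..1}" for t
    proof -
      let ?q = "proj x + t *\<^sub>R v"
      have term0: "v $ \<nu> * partial \<nu> X ?q = 0" for \<nu>
        using v zero[OF _ seg[OF t]] by (cases "\<nu> = \<mu>") simp_all
      have "frechet_derivative X (at ?q) (h *\<^sub>R v) = 0" for h
        by (simp only: frechet_derivative_partial[OF smooth_on_differentiable[OF X seg[OF t]]]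
            vector_scaleR_component real_scaleR_def mult.assoc term0 mult_zero_right sum.neutral_const)
      moreover have line: "((\<lambda>t. proj x + t *\<^sub>R v) has_derivative (\<lambda>h. h *\<^sub>R v)) (at t within {0..1})"
        by (auto intro!: derivative_eq_intros)
      ultimately show ?thesis
        using has_derivative_compose[OF line smooth_on_has_derivative[OF X seg[OF t]]] by simp
    qed
    then obtain c where c: "\<And>t. t \<in> {0..1} \<Longrightarrow> X (proj x + t *\<^sub>R v) = c"
      using has_derivative_zero_constant[of "{0..1::real}" "\<lambda>t. X (proj x + t *\<^sub>R v)"] by auto
    from c[of 0] c[of 1] show ?thesis by (simp add: v_def)
  qed
  then have "X x = \<xi> (x $ \<mu>)" if "x \<in> W" for x using that by (simp add: \<xi>_def proj_def)
  moreover have "smooth_on \<xi> ((\<lambda>x. x $ \<mu>) ` W)"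
  proof -
    have "open ((\<lambda>x. x $ \<mu>) ` W)" by (simp add: W_def open_image_vec_nth)
    moreover have shift: "p + (t - p $ \<mu>) *\<^sub>R axis \<mu> 1 = (p - p $ \<mu> *\<^sub>R axis \<mu> 1) + t *\<^sub>R axis \<mu> 1" for t
      by (simp add: algebra_simps)
    have "(p - p $ \<mu> *\<^sub>R axis \<mu> 1) + t *\<^sub>R axis \<mu> 1 \<in> \<Omega>" if "t \<in> (\<lambda>x. x $ \<mu>) ` W" for t
      using that proj r(2) unfolding shift[symmetric] by (auto simp: proj_def W_def)
    ultimately have "Ck_on k (\<lambda>t. X ((p - p $ \<mu> *\<^sub>R axis \<mu> 1) + t *\<^sub>R axis \<mu> 1)) ((\<lambda>x. x $ \<mu>) ` W)" for k
      using X unfolding smooth_on_def by (intro Ck_on_line[OF assms(1)]) auto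
    then show ?thesis by (simp only: smooth_on_def \<xi>_def[abs_def] shift simp_thms)
  qed
  ultimately show "\<exists>W \<xi>. open W \<and> p \<in> W \<and> W \<subseteq> \<Omega> \<and> smooth_on \<xi> ((\<lambda>x. x $ \<mu>) ` W) \<and>
      (\<forall>x\<in>W. X x = \<xi> (x $ \<mu>))"
    using r by (intro exI[of _ W] exI[of _ \<xi>]) (auto simp: W_def)
qed

text \<open>The functions \<open>q k\<close> are the coefficients of the interpolation polynomial, obtained by integrating the closed fields
of \<open>solution_coefficients_closed\<close>, and \<open>X \<mu>\<close> is its value at the node of \<open>\<mu>\<close>.\<close>

lemma solution_imp_potential_form:
  fixes \<Omega> :: "(real^'n::finite) set"
  assumes \<Omega>: "open \<Omega>" "simply_connected \<Omega>" and dist: "\<And>x. x \<in> \<Omega> \<Longrightarrow> inj (sq x)"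
    and d: "solves_system \<Omega> d"
  shows "has_potential_form \<Omega> d"
proof -
  define n where "n = CARD('n) - 1"
  have card: "card (UNIV - {\<mu>}) = n" for \<mu> :: 'n by (simp add: n_def)
  have Suc_n: "Suc n = CARD('n)" by (simp add: n_def)
  have sd: "smooth_on (d \<mu>) \<Omega>" for \<mu> using d by (simp add: solves_system_def)
  have "\<exists>q. smooth_on q \<Omega> \<and>
      (\<forall>x\<in>\<Omega>. \<forall>\<mu>. partial \<mu> q x = d \<mu> x * coeff (nodal_poly (sq x) (UNIV - {\<mu>})) k)" for k
    by (intro closed_coefficients_have_potential \<Omega> smooth_on_mult sd smooth_on_coeff_nodal_poly
        solution_coefficients_closed[OF \<Omega>(1) _ _ d] dist)
  then obtain q where q: "\<And>k. smooth_on (q k) \<Omega>"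
      "\<And>k x \<mu>. x \<in> \<Omega> \<Longrightarrow> partial \<mu> (q k) x = d \<mu> x * coeff (nodal_poly (sq x) (UNIV - {\<mu>})) k"
    by metis
  define X where "X \<mu> x = (\<Sum>k\<le>n. q k x * ((x $ \<mu>)\<^sup>2) ^ k)" for \<mu> x
  have pow: "smooth_on (\<lambda>x. ((x $ \<mu>)\<^sup>2) ^ k) \<Omega>" for \<mu> k by (intro smooth_intros \<Omega>)
  have "smooth_coordinate_function \<Omega> \<mu> (X \<mu>)" for \<mu>
  proof (rule smooth_coordinate_function_if_partials_vanish[OF \<Omega>(1)])
    show "smooth_on (X \<mu>) \<Omega>" unfolding X_def[abs_def] by (intro smooth_on_sum smooth_on_mult q pow \<Omega>)
    fix \<nu> x assume "\<nu> \<noteq> \<mu>" and x: "x \<in> \<Omega>"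
    note diff = smooth_on_differentiable[OF _ x]
    have zero: "partial \<nu> (\<lambda>x. ((x $ \<mu>)\<^sup>2) ^ k) x = 0" for k
      using \<open>\<nu> \<noteq> \<mu>\<close> by (intro partial_independent diff[OF pow]) (auto simp: independent_of_def axis_def)
    have "partial \<nu> (\<lambda>x. q k x * ((x $ \<mu>)\<^sup>2) ^ k) x
        = d \<nu> x * (coeff (nodal_poly (sq x) (UNIV - {\<nu>})) k * ((x $ \<mu>)\<^sup>2) ^ k)" for k
      by (simp add: partial_mult[OF diff[OF q(1)] diff[OF pow]] zero q(2)[OF x])
    then have "partial \<nu> (X \<mu>) x
        = (\<Sum>k\<le>n. d \<nu> x * (coeff (nodal_poly (sq x) (UNIV - {\<nu>})) k * ((x $ \<mu>)\<^sup>2) ^ k))"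
      unfolding X_def[abs_def]
      by (subst partial_sum) (auto intro!: diff smooth_on_mult q pow \<Omega>)
    also have "\<dots> = d \<nu> x * poly (nodal_poly (sq x) (UNIV - {\<nu>})) ((x $ \<mu>)\<^sup>2)"
      using degree_nodal_poly[of "sq x" "UNIV - {\<nu>}"] unfolding card
      by (subst poly_eq_sum_upto) (simp_all add: sum_distrib_left)
    also have "\<dots> = 0"
    proof -
      \<comment> \<open>The factor of \<open>\<kappa> = \<mu>\<close> is zero.\<close>
      have "(\<Prod>\<kappa>\<in>UNIV - {\<nu>}. (x $ \<kappa>)\<^sup>2 - (x $ \<mu>)\<^sup>2) = 0"
        using \<open>\<nu> \<noteq> \<mu>\<close> by (intro prod_zero) auto
      then show ?thesis by (simp add: poly_nodal_poly)
    qed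
    finally show "partial \<nu> (X \<mu>) x = 0" .
  qed
  moreover have "d \<mu> x = partial \<mu> (potential X) x" if x: "x \<in> \<Omega>" for \<mu> x
  proof -
    \<comment> \<open>Of all coefficients only the top one survives the summation over the nodes.\<close>
    have pot: "(- 1) ^ n * q n x = potential X x" if x: "x \<in> \<Omega>" for x
    proof -
      have "potential X x = (\<Sum>\<mu>\<in>UNIV. \<Sum>k\<le>n. q k x * (((x $ \<mu>)\<^sup>2) ^ k / U \<mu> x))"
        by (simp add: potential_def X_def sum_divide_distrib)
      also have "\<dots> = (\<Sum>k\<le>n. q k x * (\<Sum>\<mu>\<in>UNIV. ((x $ \<mu>)\<^sup>2) ^ k / U \<mu> x))"
        by (subst sum.swap) (simp add: sum_distrib_left)
      also have "\<dots> = (\<Sum>k\<le>n. q k x * (if k = n then (- 1) ^ n else 0))"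
        unfolding U_def using dist[OF x] Suc_n
        by (intro sum.cong refl) (simp add: sum_powers_div_nodal n_def)
      also have "\<dots> = (- 1) ^ n * q n x" by (simp add: if_distrib cong: if_cong)
      finally show ?thesis by simp
    qed
    have "smooth_on (\<lambda>x. (- 1) ^ n * q n x) \<Omega>" by (intro smooth_on_mult smooth_on_const q \<Omega>)
    then have "partial \<mu> (\<lambda>x. (- 1) ^ n * q n x) x = partial \<mu> (potential X) x"
      by (intro partial_cong_open[OF \<Omega>(1) x pot] smooth_on_differentiable[OF _ x])
    then have "partial \<mu> (potential X) x = (- 1) ^ n * partial \<mu> (q n) x"
      using partial_mult[OF differentiable_const smooth_on_differentiable[OF q(1) x]]
      by (simp add: partial_def)
    also have "partial \<mu> (q n) x = d \<mu> x * (- 1) ^ n"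
      using q(2)[OF x, of \<mu> n] coeff_nodal_poly_card[of "UNIV - {\<mu>}" "sq x"] by (simp add: card)
    also have "(- 1) ^ n * (d \<mu> x * (- 1) ^ n) = d \<mu> x"
      by (simp add: mult.left_commute flip: power_mult_distrib)
    finally show ?thesis by simp
  qed
  ultimately show ?thesis unfolding has_potential_form_def by blast
qed

theorem theorem8:
  fixes \<Omega> :: "(real^'n::finite) set"
  assumes "open \<Omega>" and "connected \<Omega>"
    and no_diagonal: "\<And>x \<mu> \<nu>. x \<in> \<Omega> \<Longrightarrow> \<mu> \<noteq> \<nu> \<Longrightarrow> x $ \<mu> \<noteq> x $ \<nu> \<and> x $ \<mu> \<noteq> - (x $ \<nu>)"
  shows "(\<forall>d. has_potential_form \<Omega> d \<longrightarrow> solves_system \<Omega> d) \<and>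
         (simply_connected \<Omega> \<and> (\<forall>x\<in>\<Omega>. \<forall>\<mu>. x $ \<mu> \<noteq> 0) \<longrightarrow>
            (\<forall>d. solves_system \<Omega> d \<longrightarrow> has_potential_form \<Omega> d))"
proof -
  have "inj (sq x)" if "x \<in> \<Omega>" for x
    using no_diagonal[OF that] by (intro injI) (metis power2_eq_iff)
  then show ?thesis
    using potential_form_imp_solution[OF assms(1)] solution_imp_potential_form[OF assms(1)] by blast
qed

end
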